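(* Let $X\in\{\mathcal{M}_n(\mathbb{F}),\mathcal{H}_n(\mathbb{F})\}$, let $\|\cdot\|$ be an admissible norm on $X$, and let $(k,l)=(k(X),l(X))$. Let $(G,p)$ be a completely full and well-positioned bar-joint framework in $(X,\|\cdot\|)$. If $(G,p)$ is minimally infinitesimally rigid, then $G$ is $(k,l)$-tight.
   Context: Matrix spaces. $n\ge 2$ is an integer, $\mathbb{F}\in\{\mathbb{R},\mathbb{C}\}$, $\mathcal{M}_n(\mathbb{F})$ is the space of $n\times n$ matrices over $\mathbb{F}$ and $\mathcal{H}_n(\mathbb{F})$ is the real space of hermitian (symmetric, if $\mathbb{F}=\mathbb{R}$) matrices. $\mathcal{U}_n(\mathbb{F})$ is the set of unitary (orthogonal) matrices, $a^*$ the conjugate transpose, $e_{ij}$ the matrix units. All spaces are regarded as real linear spaces. A norm on $\mathcal{M}_n(\mathbb{F})$ is unitarily invariant if $\|a\|=\|uaw\|$ for all $a$ and all $u,w\in\mathcal{U}_n(\mathbb{F})$. A test set is a finite set $\Gamma$ of real-linear maps $\mathcal{M}_n(\mathbb{F})\to\mathcal{M}_n(\mathbb{F})$ containing the identity and with $\gamma(I)=I$ for all $\gamma\in\Gamma$. For a real-linear subspace $X$, $X^\Gamma=\bigcup_{\gamma\in\Gamma}\{y\in\mathcal{M}_n(\mathbb{F}): xy=y\gamma(x)\ \forall x\in X\}$; $X$ is $\Gamma$-large if $I\in X$ and $X^\Gamma=\mathbb{F}I$. $(X,\|\cdot\|)$ has the $\Gamma$-isometry property if every real-linear isometry $A:X\to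 X$ has the form $A(x)=u\gamma(x)w$ with $u,w\in\mathcal{U}_n(\mathbb{F})$, $\gamma\in\Gamma$. $(X,\|\cdot\|)$, with $\|\cdot\|$ a unitarily invariant norm on $\mathcal{M}_n(\mathbb{F})$, is an admissible matrix space (in $\mathcal{M}_n(\mathbb{F})$), and $\|\cdot\|$ is called an admissible norm on $X$, if (a) for some test set $\Gamma$, $X$ is $\Gamma$-large and $(X,\|\cdot\|)$ has the $\Gamma$-isometry property; (b) there are scalars $\lambda_i\in\mathbb{F}$ $(1\le i\le n)$ with $e_{ii}\in X$ and $e_{1i}+\lambda_ie_{i1}\in X$; (c) $x^*\in X$ for all $x\in X$. Values of $k(X),l(X)$: $\mathcal{H}_n(\mathbb{R})$: $k=\tfrac12n(n+1)$, $l=n^2$; $\mathcal{M}_n(\mathbb{R})$: $k=n^2$, $l=2n^2-n$; $\mathcal{H}_n(\mathbb{C})$: $k=n^2$, $l=2n^2-1$; $\mathcal{M}_n(\mathbb{C})$: $k=2n^2$, $l=4n^2-1$. Rigid motions. A rigid motion of a normed space $(X,\|\cdot\|)$ is a family of continuous paths $\{\alpha_x:[-1,1]\to X\}_{x\in X}$ with $\alpha_x(0)=x$, $\alpha_x$ differentiable at $0$, and $\|\alpha_x(t)-\alpha_y(t)\|=\|x-y\|$ for all $x,y\in X$, $t\in[-1,1]$. $\mathcal{T}(X,\|\cdot\|)$ is the space of maps $\eta:X\to X$ of the form $\eta(x)=\alpha_x'(0)$ for a rigid motion $\alpha$. Frameworks. $G=(V,E)$ is a finite simple graph. A bar-joint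 framework $(G,p)$ in $X$ is $G$ with a map $p:V\to X$, $v\mapsto p_v$, such that $p_v\ne p_w$ for all $vw\in E$. A subframework $(H,p_H)$ consists of a subgraph $H=(V(H),E(H))$ of $G$ and $p_H=p|_{V(H)}$. A support functional for a unit vector $x_0\in X$ is a linear functional $f:X\to\mathbb{R}$ with $\|f\|\le 1$ and $f(x_0)=1$; the norm is smooth at $x\ne 0$ if $x/\|x\|$ has exactly one support functional. $(G,p)$ is well-positioned if the norm is smooth at $p_v-p_w$ for every $vw\in E$. A non-empty set $S\subseteq X$ is full in $(X,\|\cdot\|)$ if the map $\mathcal{T}(X,\|\cdot\|)\to X^S$, $\eta\mapsto(\eta(x))_{x\in S}$, is injective; $(G,p)$ is full if $\{p_v:v\in V\}$ is full; $(G,p)$ is completely full if $(G,p)$, and every subframework $(H,p_H)$ of it with $|V(H)|\ge 2\dim(X)$ (real dimension), is full. With $f_G:X^V\to\mathbb{R}^E$, $f_G((x_v)_{v\in V})=(\|x_v-x_w\|)_{vw\in E}$, an infinitesimal flex of $(G,p)$ is $z\in X^V$ with $\lim_{t\to0}\frac1t(f_G(p+tz)-f_G(p))=0$. It is trivial if $z=\eta\circ p$ for some $\eta\in\mathcal{T}(X,\|\cdot\|)$. $(G,p)$ is infinitesimally rigid if every infinitesimal flex is trivial, and infinitesimally flexible otherwise. It is minimally infinitesimally rigid if it is infinitesimally rigid and every subframework obtained by removing an edge from $G$ is infinitesimally flexible. Sparsity. For $k,l\in\mathbb{N}$ with $l\in\{0,\dots,2k-1\}$, $G$ is $(k,l)$-sparse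 if every subgraph $H$ with $|V(H)|\ge2$ has at most $k|V(H)|-l$ edges, and $(k,l)$-tight if in addition $|E|=k|V|-l$. *)

theory Defs
  imports "HOL-Analysis.Analysis" "HOL-Library.FuncSet"
begin

text \<open>
  A normed space \<open>(X, N)\<close> is a real subspace \<open>X\<close> of a Euclidean space with a norm \<open>N\<close>
  whose values off the carrier are irrelevant. Maps whose domain is a carrier are kept
  \<^const>\<open>extensional\<close>, so that equality of functions (in uniqueness and injectivity
  statements) is equality of maps on the carrier.
\<close>

definition norm_on :: "'a::real_vector set \<Rightarrow> ('a \<Rightarrow> real) \<Rightarrow> bool" where
  "norm_on X N \<longleftrightarrow>
     (\<forall>x\<in>X. N x \<ge> 0 \<and> (N x = 0 \<longleftrightarrow> x = 0)) \<and>
     (\<forall>r. \<forall>x\<in>X. N (r *\<^sub>R x) = \<bar>r\<bar> * N x) \<and>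
     (\<forall>x\<in>X. \<forall>y\<in>X. N (x + y) \<le> N x + N y)"

definition real_linear_on :: "'a::real_vector set \<Rightarrow> 'b::real_vector set \<Rightarrow> ('a \<Rightarrow> 'b) \<Rightarrow> bool" where
  "real_linear_on X Y f \<longleftrightarrow>
     f \<in> X \<rightarrow>\<^sub>E Y \<and>
     (\<forall>x\<in>X. \<forall>y\<in>X. f (x + y) = f x + f y) \<and>
     (\<forall>r. \<forall>x\<in>X. f (r *\<^sub>R x) = r *\<^sub>R f x)"


section \<open>Matrix spaces\<close>

text \<open>
  The field \<open>\<real>\<close> or \<open>\<complex>\<close> is a subset \<open>F\<close> of the complex numbers, either \<^term>\<open>\<real>\<close>
  or \<^term>\<open>UNIV\<close>, so real matrices are the complex matrices with real entries.
\<close>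

definition matrices :: "complex set \<Rightarrow> (complex^'n^'n) set" where
  "matrices F = {a. \<forall>i j. a $ i $ j \<in> F}"

definition conj_transpose :: "complex^'n^'n \<Rightarrow> complex^'n^'n" where
  "conj_transpose a = (\<chi> i j. cnj (a $ j $ i))"

definition hermitian_matrices :: "complex set \<Rightarrow> (complex^'n^'n) set" where
  "hermitian_matrices F = {a \<in> matrices F. conj_transpose a = a}"

definition unitary_matrices :: "complex set \<Rightarrow> (complex^'n^'n) set" where
  "unitary_matrices F =
     {u \<in> matrices F. u ** conj_transpose u = mat 1 \<and> conj_transpose u ** u = mat 1}"

definition matrix_unit :: "'n \<Rightarrow> 'n \<Rightarrow> complex^'n^'n" where
  "matrix_unit i j = (\<chi> r s. if r = i \<and> s = j then 1 else 0)"

text \<open>Homogeneity of \<^const>\<open>norm_on\<close> over \<open>\<real>\<close> suffices here: scalars of modulus one in \<open>F\<close>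
  give unitary matrices, so unitary invariance yields homogeneity over \<open>F\<close>.\<close>

definition unitarily_invariant_norm :: "complex set \<Rightarrow> (complex^'n^'n \<Rightarrow> real) \<Rightarrow> bool" where
  "unitarily_invariant_norm F N \<longleftrightarrow>
     norm_on (matrices F) N \<and>
     (\<forall>a\<in>matrices F. \<forall>u\<in>unitary_matrices F. \<forall>w\<in>unitary_matrices F. N a = N (u ** a ** w))"

definition test_set :: "complex set \<Rightarrow> (complex^'n^'n \<Rightarrow> complex^'n^'n) set \<Rightarrow> bool" where
  "test_set F \<Gamma> \<longleftrightarrow>
     finite \<Gamma> \<and>
     (\<forall>\<gamma>\<in>\<Gamma>. real_linear_on (matrices F) (matrices F) \<gamma> \<and> \<gamma> (mat 1) = mat 1) \<and>
     restrict id (matrices F) \<in> \<Gamma>"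

definition twisted_commutant ::
    "complex set \<Rightarrow> (complex^'n^'n \<Rightarrow> complex^'n^'n) set \<Rightarrow> (complex^'n^'n) set \<Rightarrow> (complex^'n^'n) set" where
  "twisted_commutant F \<Gamma> X = (\<Union>\<gamma>\<in>\<Gamma>. {y \<in> matrices F. \<forall>x\<in>X. x ** y = y ** \<gamma> x})"

definition large_subspace ::
    "complex set \<Rightarrow> (complex^'n^'n \<Rightarrow> complex^'n^'n) set \<Rightarrow> (complex^'n^'n) set \<Rightarrow> bool" where
  "large_subspace F \<Gamma> X \<longleftrightarrow>
     mat 1 \<in> X \<and> twisted_commutant F \<Gamma> X = {mat c | c. c \<in> F}"

definition isometry_property ::
    "complex set \<Rightarrow> (complex^'n^'n \<Rightarrow> complex^'n^'n) set \<Rightarrow> (complex^'n^'n) set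
      \<Rightarrow> (complex^'n^'n \<Rightarrow> real) \<Rightarrow> bool" where
  "isometry_property F \<Gamma> X N \<longleftrightarrow>
     (\<forall>A. real_linear_on X X A \<and> (\<forall>x\<in>X. N (A x) = N x) \<longrightarrow>
        (\<exists>u\<in>unitary_matrices F. \<exists>w\<in>unitary_matrices F. \<exists>\<gamma>\<in>\<Gamma>. \<forall>x\<in>X. A x = u ** \<gamma> x ** w))"

text \<open>Matrices are indexed by an arbitrary finite type, which has no distinguished first
  element; the parameter \<open>o1\<close> is the index playing the role of \<open>1\<close> in \<open>e\<^sub>1\<^sub>i\<close> and \<open>e\<^sub>i\<^sub>1\<close>.\<close>

definition admissible_matrix_space ::
    "complex set \<Rightarrow> 'n \<Rightarrow> (complex^'n^'n) set \<Rightarrow> (complex^'n^'n \<Rightarrow> real) \<Rightarrow> bool" where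
  "admissible_matrix_space F o1 X N \<longleftrightarrow>
     subspace X \<and> X \<subseteq> matrices F \<and> unitarily_invariant_norm F N \<and>
     (\<exists>\<Gamma>. test_set F \<Gamma> \<and> large_subspace F \<Gamma> X \<and> isometry_property F \<Gamma> X N) \<and>
     (\<exists>c. \<forall>i. c i \<in> F \<and> matrix_unit i i \<in> X \<and>
        matrix_unit o1 i + mat (c i) ** matrix_unit i o1 \<in> X) \<and>
     (\<forall>x\<in>X. conj_transpose x \<in> X)"


section \<open>Rigid motions\<close>

text \<open>Continuity and differentiability refer to the ambient Euclidean topology, which on the
  finite-dimensional space \<open>X\<close> coincides with the topology of any norm \<open>N\<close> on \<open>X\<close>.\<close>

definition rigid_motion ::
    "'a::euclidean_space set \<Rightarrow> ('a \<Rightarrow> real) \<Rightarrow> ('a \<Rightarrow> real \<Rightarrow> 'a) \<Rightarrow> bool" where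
  "rigid_motion X N \<alpha> \<longleftrightarrow>
     (\<forall>x\<in>X. continuous_on {-1..1} (\<alpha> x) \<and> \<alpha> x ` {-1..1} \<subseteq> X \<and>
        \<alpha> x 0 = x \<and> \<alpha> x differentiable (at 0)) \<and>
     (\<forall>x\<in>X. \<forall>y\<in>X. \<forall>t\<in>{-1..1}. N (\<alpha> x t - \<alpha> y t) = N (x - y))"

definition infinitesimal_motions ::
    "'a::euclidean_space set \<Rightarrow> ('a \<Rightarrow> real) \<Rightarrow> ('a \<Rightarrow> 'a) set" where
  "infinitesimal_motions X N =
     {\<eta> \<in> X \<rightarrow>\<^sub>E X. \<exists>\<alpha>. rigid_motion X N \<alpha> \<and> (\<forall>x\<in>X. \<eta> x = vector_derivative (\<alpha> x) (at 0))}"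

definition full_set :: "'a::euclidean_space set \<Rightarrow> ('a \<Rightarrow> real) \<Rightarrow> 'a set \<Rightarrow> bool" where
  "full_set X N S \<longleftrightarrow>
     S \<noteq> {} \<and> S \<subseteq> X \<and> inj_on (\<lambda>\<eta>. restrict \<eta> S) (infinitesimal_motions X N)"


section \<open>Smoothness\<close>

definition support_functional ::
    "'a::euclidean_space set \<Rightarrow> ('a \<Rightarrow> real) \<Rightarrow> 'a \<Rightarrow> ('a \<Rightarrow> real) \<Rightarrow> bool" where
  "support_functional X N x0 f \<longleftrightarrow>
     real_linear_on X UNIV f \<and> (\<forall>x\<in>X. \<bar>f x\<bar> \<le> N x) \<and> f x0 = 1"

definition smooth_at :: "'a::euclidean_space set \<Rightarrow> ('a \<Rightarrow> real) \<Rightarrow> 'a \<Rightarrow> bool" where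
  "smooth_at X N x \<longleftrightarrow> x \<noteq> 0 \<and> (\<exists>!f. support_functional X N (x /\<^sub>R N x) f)"


section \<open>Graphs and frameworks\<close>

definition simple_graph :: "'v set \<Rightarrow> 'v set set \<Rightarrow> bool" where
  "simple_graph V E \<longleftrightarrow> finite V \<and> (\<forall>e\<in>E. e \<subseteq> V \<and> card e = 2)"

definition is_subgraph :: "'v set \<Rightarrow> 'v set set \<Rightarrow> 'v set \<Rightarrow> 'v set set \<Rightarrow> bool" where
  "is_subgraph V' E' V E \<longleftrightarrow> simple_graph V' E' \<and> V' \<subseteq> V \<and> E' \<subseteq> E"

definition sparse_graph :: "nat \<Rightarrow> nat \<Rightarrow> 'v set \<Rightarrow> 'v set set \<Rightarrow> bool" where
  "sparse_graph k l V E \<longleftrightarrow>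
     (\<forall>V' E'. is_subgraph V' E' V E \<and> card V' \<ge> 2 \<longrightarrow>
        int (card E') \<le> int k * int (card V') - int l)"

definition tight_graph :: "nat \<Rightarrow> nat \<Rightarrow> 'v set \<Rightarrow> 'v set set \<Rightarrow> bool" where
  "tight_graph k l V E \<longleftrightarrow>
     sparse_graph k l V E \<and> int (card E) = int k * int (card V) - int l"

definition framework :: "'a::euclidean_space set \<Rightarrow> 'v set \<Rightarrow> 'v set set \<Rightarrow> ('v \<Rightarrow> 'a) \<Rightarrow> bool" where
  "framework X V E p \<longleftrightarrow>
     simple_graph V E \<and> p \<in> V \<rightarrow> X \<and> (\<forall>v w. {v, w} \<in> E \<longrightarrow> p v \<noteq> p w)"

definition well_positioned ::
    "'a::euclidean_space set \<Rightarrow> ('a \<Rightarrow> real) \<Rightarrow> 'v set set \<Rightarrow> ('v \<Rightarrow> 'a) \<Rightarrow> bool" where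
  "well_positioned X N E p \<longleftrightarrow> (\<forall>v w. {v, w} \<in> E \<longrightarrow> smooth_at X N (p v - p w))"

definition full_framework ::
    "'a::euclidean_space set \<Rightarrow> ('a \<Rightarrow> real) \<Rightarrow> 'v set \<Rightarrow> ('v \<Rightarrow> 'a) \<Rightarrow> bool" where
  "full_framework X N V p \<longleftrightarrow> full_set X N (p ` V)"

definition completely_full ::
    "'a::euclidean_space set \<Rightarrow> ('a \<Rightarrow> real) \<Rightarrow> 'v set \<Rightarrow> 'v set set \<Rightarrow> ('v \<Rightarrow> 'a) \<Rightarrow> bool" where
  "completely_full X N V E p \<longleftrightarrow>
     full_framework X N V p \<and>
     (\<forall>V' E'. is_subgraph V' E' V E \<and> card V' \<ge> 2 * dim X \<longrightarrow> full_framework X N V' p)"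

text \<open>Since \<open>E\<close> is finite, the limit in \<open>\<real>\<^sup>E\<close> defining a flex is taken edge by edge.\<close>

definition infinitesimal_flex ::
    "'a::euclidean_space set \<Rightarrow> ('a \<Rightarrow> real) \<Rightarrow> 'v set \<Rightarrow> 'v set set \<Rightarrow> ('v \<Rightarrow> 'a) \<Rightarrow> ('v \<Rightarrow> 'a) \<Rightarrow> bool" where
  "infinitesimal_flex X N V E p z \<longleftrightarrow>
     z \<in> V \<rightarrow> X \<and>
     (\<forall>v w. {v, w} \<in> E \<longrightarrow>
        ((\<lambda>t. (1 / t) * (N ((p v + t *\<^sub>R z v) - (p w + t *\<^sub>R z w)) - N (p v - p w)))
           \<longlongrightarrow> 0) (at 0))"

definition trivial_flex ::
    "'a::euclidean_space set \<Rightarrow> ('a \<Rightarrow> real) \<Rightarrow> 'v set \<Rightarrow> ('v \<Rightarrow> 'a) \<Rightarrow> ('v \<Rightarrow> 'a) \<Rightarrow> bool" where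
  "trivial_flex X N V p z \<longleftrightarrow> (\<exists>\<eta>\<in>infinitesimal_motions X N. \<forall>v\<in>V. z v = \<eta> (p v))"

definition infinitesimally_rigid ::
    "'a::euclidean_space set \<Rightarrow> ('a \<Rightarrow> real) \<Rightarrow> 'v set \<Rightarrow> 'v set set \<Rightarrow> ('v \<Rightarrow> 'a) \<Rightarrow> bool" where
  "infinitesimally_rigid X N V E p \<longleftrightarrow>
     (\<forall>z. infinitesimal_flex X N V E p z \<longrightarrow> trivial_flex X N V p z)"

definition minimally_infinitesimally_rigid ::
    "'a::euclidean_space set \<Rightarrow> ('a \<Rightarrow> real) \<Rightarrow> 'v set \<Rightarrow> 'v set set \<Rightarrow> ('v \<Rightarrow> 'a) \<Rightarrow> bool" where
  "minimally_infinitesimally_rigid X N V E p \<longleftrightarrow>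
     infinitesimally_rigid X N V E p \<and>
     (\<forall>e\<in>E. \<not> infinitesimally_rigid X N V (E - {e}) p)"

end

theory Submission
  imports Defs "HOL-Library.Function_Algebras"
begin

text \<open>
  Write \<open>T\<close> for the infinitesimal motions of \<open>(X, N)\<close>. The numbers \<open>k\<close> and \<open>l\<close> are the real dimensions of
  \<open>X\<close> and of \<open>T\<close>, and the theorem is a Maxwell count: a framework on \<open>m\<close> vertices has \<open>k m\<close> degrees of
  freedom, of which \<open>l\<close> are used by trivial flexes, and each edge imposes one linear condition.

  The analytic part is the description of \<open>T\<close>: it consists of the maps
  \<open>x \<mapsto> c + [a, x] + x d\<close> with \<open>c\<close> in \<open>X\<close>, \<open>a\<close> skew-hermitian and determined up to scalars, and \<open>d\<close> a
  skew-hermitian element of \<open>X\<close>. That these are infinitesimal motions follows from unitary invariance,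
  with paths of unitary matrices given by Cayley transforms (\<open>killing_is_motion\<close>). Conversely
  (\<open>motion_is_killing\<close>), at each time a rigid motion is an isometry of a finite-dimensional space, hence
  onto and, by the Mazur-Ulam theorem (\<open>isometry_linear\<close>), affine. The isometry property makes its linear
  part \<open>u \<gamma>(x) w\<close>; finiteness of the test set, compactness of the unitary matrices and largeness of \<open>X\<close>
  exclude all \<open>\<gamma>\<close> that are nontrivial on \<open>X\<close> at small times (\<open>isometry_near_identity\<close>), and \<open>u x w\<close> can then be
  differentiated at \<open>0\<close>.

  The combinatorial part (\<open>tight_if_minimally_rigid\<close>) uses of well-positionedness that the rate of change
  of an edge length is a linear functional of the velocities (\<open>smooth_imp_Gateaux\<close>). If the framework is
  minimally rigid, deleting an edge creates a flex that changes the length of this edge only. These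
  velocity assignments form a basis of \<open>X\<^sup>V\<close> modulo the trivial flexes, whose space has dimension \<open>l\<close> by fullness; so
  the number of edges is \<open>k m - l\<close>. Restricted to a full subframework they remain independent modulo
  the trivial flexes, which bounds its number of edges. Complete fullness covers the subgraphs with
  at least \<open>2k\<close> vertices; smaller ones with at least two vertices satisfy the bound merely because they are simple graphs and
  \<open>l < 2k\<close> (\<open>card_edges_small\<close>).
\<close>

section \<open>Norms on a subspace of a Euclidean space\<close>

lemma eq_neg_self_iff: "a = - a \<longleftrightarrow> a = 0" for a :: "'a::real_vector"
proof
  assume "a = - a"
  then have "2 *\<^sub>R a = 0" by (simp add: scaleR_2 eq_neg_iff_add_eq_0)
  then show "a = 0" by simp
qed simp

locale normed_subspace =
  fixes X :: "'a::euclidean_space set" and N :: "'a \<Rightarrow> real"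
  assumes subspace: "subspace X" and norm_on: "norm_on X N"
begin

lemma subspace_mem [simp, intro]:
  "0 \<in> X" "x \<in> X \<Longrightarrow> y \<in> X \<Longrightarrow> x + y \<in> X" "x \<in> X \<Longrightarrow> y \<in> X \<Longrightarrow> x - y \<in> X"
  "x \<in> X \<Longrightarrow> r *\<^sub>R x \<in> X" "x \<in> X \<Longrightarrow> - x \<in> X"
  using subspace by (auto intro: subspace_0 subspace_add subspace_diff subspace_scale subspace_neg)

lemma N_nonneg: "x \<in> X \<Longrightarrow> N x \<ge> 0"
  and N_eq_0: "x \<in> X \<Longrightarrow> N x = 0 \<longleftrightarrow> x = 0"
  and N_scale: "x \<in> X \<Longrightarrow> N (r *\<^sub>R x) = \<bar>r\<bar> * N x"
  and N_triangle: "x \<in> X \<Longrightarrow> y \<in> X \<Longrightarrow> N (x + y) \<le> N x + N y"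
  using norm_on by (auto simp: norm_on_def)

lemma N_zero [simp]: "N 0 = 0" by (simp add: N_eq_0)

lemma N_pos: "x \<in> X \<Longrightarrow> x \<noteq> 0 \<Longrightarrow> N x > 0"
  using N_nonneg N_eq_0 by (metis less_eq_real_def)

lemma N_minus: "x \<in> X \<Longrightarrow> N (- x) = N x"
  using N_scale[of x "-1"] by simp

lemma N_diff_commute: "x \<in> X \<Longrightarrow> y \<in> X \<Longrightarrow> N (x - y) = N (y - x)"
  using N_minus[of "x - y"] by simp

lemma N_triangle_diff: "x \<in> X \<Longrightarrow> y \<in> X \<Longrightarrow> z \<in> X \<Longrightarrow> N (x - z) \<le> N (x - y) + N (y - z)"
  using N_triangle[of "x - y" "y - z"] by simp

lemma N_diff_bound: "x \<in> X \<Longrightarrow> y \<in> X \<Longrightarrow> \<bar>N x - N y\<bar> \<le> N (x - y)"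
  using N_triangle[of "x - y" y] N_triangle[of "y - x" x] N_diff_commute[of x y] by auto

lemma N_sum: "finite B \<Longrightarrow> (\<And>b. b \<in> B \<Longrightarrow> f b \<in> X) \<Longrightarrow> N (sum f B) \<le> (\<Sum>b\<in>B. N (f b))"
proof (induction B rule: finite_induct)
  case (insert b B)
  have "sum f B \<in> X" using insert by (intro subspace_sum[OF subspace]) auto
  then have "N (f b + sum f B) \<le> N (f b) + N (sum f B)" using insert by (intro N_triangle) auto
  then show ?case using insert by auto
qed simp

lemma N_upper: obtains C where "C > 0" "\<And>x. x \<in> X \<Longrightarrow> N x \<le> C * norm x"
proof -
  obtain B where B: "B \<subseteq> X" "pairwise orthogonal B" "\<And>b. b \<in> B \<Longrightarrow> norm b = 1" "independent B"
    "span B = X"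
    using orthonormal_basis_subspace[OF subspace] by metis
  have fin: "finite B" using B(4) by (rule independent_imp_finite)
  define C where "C = 1 + (\<Sum>b\<in>B. N b)"
  have "N x \<le> C * norm x" if "x \<in> X" for x
  proof -
    have x: "x = (\<Sum>b\<in>B. (b \<bullet> x) *\<^sub>R b)"
      using orthonormal_basis_expand[of B x] B fin that by (auto simp: inner_commute)
    have "N x \<le> (\<Sum>b\<in>B. N ((b \<bullet> x) *\<^sub>R b))"
      by (subst x) (rule N_sum, use fin B(1) in auto)
    also have "\<dots> = (\<Sum>b\<in>B. \<bar>b \<bullet> x\<bar> * N b)" using B by (intro sum.cong) (auto simp: N_scale)
    also have "\<dots> \<le> (\<Sum>b\<in>B. norm x * N b)"
    proof (rule sum_mono)
      fix b assume "b \<in> B"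
      then show "\<bar>b \<bullet> x\<bar> * N b \<le> norm x * N b"
        using Cauchy_Schwarz_ineq2[of b x] B by (intro mult_right_mono N_nonneg) auto
    qed
    also have "\<dots> \<le> norm x * C" by (simp add: C_def distrib_left sum_distrib_left)
    finally show ?thesis by (simp add: mult.commute)
  qed
  moreover have "C > 0" unfolding C_def using B by (intro add_pos_nonneg sum_nonneg N_nonneg) auto
  ultimately show thesis using that by blast
qed

lemma continuous_on_N: "continuous_on X N"
proof -
  obtain C where C: "C > 0" "\<And>x. x \<in> X \<Longrightarrow> N x \<le> C * norm x" using N_upper by blast
  show ?thesis
  proof (rule continuous_onI)
    fix x e :: _ assume x: "x \<in> X" and e: "(e::real) > 0"
    have "dist (N y) (N x) \<le> e" if "y \<in> X" "dist y x < e / C" for y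
    proof -
      have "dist (N y) (N x) \<le> C * norm (y - x)"
        using N_diff_bound[of y x] C(2)[of "y - x"] that x by (auto simp: dist_real_def)
      also have "\<dots> \<le> e" using that C by (simp add: dist_norm field_simps)
      finally show ?thesis .
    qed
    then show "\<exists>d>0. \<forall>x'\<in>X. dist x' x < d \<longrightarrow> dist (N x') (N x) \<le> e"
      using e C by (intro exI[of _ "e / C"]) auto
  qed
qed

lemma N_lower: obtains c where "c > 0" "\<And>x. x \<in> X \<Longrightarrow> c * norm x \<le> N x"
proof -
  let ?S = "sphere 0 1 \<inter> X"
  have comp: "compact ?S" using subspace by (intro compact_Int_closed closed_subspace) auto
  show thesis
  proof (cases "?S = {}")
    case True
    have "x = 0" if "x \<in> X" for x
    proof (rule ccontr)
      assume "x \<noteq> 0"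
      then have "x /\<^sub>R norm x \<in> ?S" using that by auto
      with True show False by blast
    qed
    then show thesis using that[of 1] by (metis N_zero mult_cancel_left1 norm_zero order_refl zero_less_one
      mult_zero_right)
  next
    case False
    obtain s where s: "s \<in> ?S" "\<And>y. y \<in> ?S \<Longrightarrow> N s \<le> N y"
      using continuous_attains_inf[OF comp False] continuous_on_subset[OF continuous_on_N] by blast
    have "N s > 0" using s(1) by (intro N_pos) auto
    moreover have "N s * norm x \<le> N x" if "x \<in> X" for x
    proof (cases "x = 0")
      case False
      have "N s \<le> N (x /\<^sub>R norm x)" using that False by (intro s(2)) auto
      then show ?thesis using False that by (simp add: N_scale field_simps)
    qed auto
    ultimately show thesis using that by blast
  qed
qed

subsection \<open>Isometries\<close>

text \<open>
Isometries of a compact metric space into itself are onto, and the closed balls around \<open>0\<close> are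
compact. Rigid motions are not assumed to be onto, so this is what makes the Mazur-Ulam argument
below applicable to them.
\<close>

lemma isometry_surjective:
  assumes f: "f ` X \<subseteq> X" and iso: "\<And>x y. x \<in> X \<Longrightarrow> y \<in> X \<Longrightarrow> N (f x - f y) = N (x - y)"
    and f0: "f 0 = 0"
  shows "f ` X = X"
proof (rule ccontr)
  assume "f ` X \<noteq> X"
  then obtain y where y: "y \<in> X" "y \<notin> f ` X" using f by auto
  obtain c where c: "c > 0" "\<And>x. x \<in> X \<Longrightarrow> c * norm x \<le> N x" using N_lower by blast
  obtain C where C: "C > 0" "\<And>x. x \<in> X \<Longrightarrow> N x \<le> C * norm x" using N_upper by blast
  define K where "K = X \<inter> N -` {..N y}"
  have "closed K" unfolding K_def
    using continuous_on_N closed_subspace[OF subspace] by (intro continuous_closed_preimage) auto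
  moreover have "bounded K"
  proof (rule boundedI)
    fix x assume "x \<in> K"
    then have "c * norm x \<le> N y" using c(2)[of x] by (auto simp: K_def)
    then show "norm x \<le> N y / c" using c(1) by (simp add: field_simps)
  qed
  ultimately have K: "compact K" by (simp add: compact_eq_bounded_closed)
  have fK: "f x \<in> K" if "x \<in> K" for x
    using that iso[of x 0] f f0 by (auto simp: K_def)
  have contf: "continuous_on K f"
  proof (rule continuous_onI)
    fix x e :: _ assume x: "x \<in> K" and e: "(e::real) > 0"
    have "dist (f z) (f x) \<le> e" if z: "z \<in> K" "dist z x < c * e / C" for z
    proof -
      have "c * norm (f z - f x) \<le> N (z - x)"
        using c(2)[of "f z - f x"] iso[of z x] x z f by (auto simp: K_def)
      also have "\<dots> \<le> C * norm (z - x)" using C(2)[of "z - x"] x z by (auto simp: K_def)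
      also have "\<dots> \<le> c * e" using that C by (simp add: dist_norm field_simps)
      finally show ?thesis using c(1) by (simp add: dist_norm)
    qed
    then show "\<exists>d>0. \<forall>z\<in>K. dist z x < d \<longrightarrow> dist (f z) (f x) \<le> e"
      using e c C by (intro exI[of _ "c * e / C"]) auto
  qed
  have yK: "y \<in> K" using y by (auto simp: K_def)
  have cont: "continuous_on (f ` K) (\<lambda>x. N (y - x))"
    by (rule continuous_on_compose2[OF continuous_on_N])
       (use fK y in \<open>auto intro!: continuous_intros simp: K_def\<close>)
  obtain w where w: "w \<in> f ` K" "\<And>x. x \<in> f ` K \<Longrightarrow> N (y - w) \<le> N (y - x)"
    using continuous_attains_inf[OF compact_continuous_image[OF contf K] _ cont] yK by blast
  define \<epsilon> where "\<epsilon> = N (y - w)"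
  have "y - w \<noteq> 0" "y - w \<in> X" using w(1) y fK by (auto simp: K_def)
  then have \<epsilon>: "\<epsilon> > 0" unfolding \<epsilon>_def by (intro N_pos)
  define s where "s n = (f ^^ n) y" for n
  have sK: "s n \<in> K" for n by (induction n) (auto simp: s_def yK fK)
  have shift: "N (s (m + n) - s (m + k)) = N (s n - s k)" for m n k
  proof (induction m)
    case (Suc m)
    have "N (s (Suc m + n) - s (Suc m + k)) = N (f (s (m + n)) - f (s (m + k)))" by (simp add: s_def)
    also have "\<dots> = N (s (m + n) - s (m + k))" using sK by (intro iso) (auto simp: K_def)
    finally show ?case using Suc by simp
  qed simp
  \<comment> \<open>The orbit of \<open>y\<close> never comes back near \<open>y\<close>, hence its points keep a distance \<open>\<epsilon>\<close>.\<close>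
  have sep: "\<epsilon> \<le> N (s m - s n)" if "m < n" for m n
  proof -
    have "n = m + Suc (n - Suc m)" using that by simp
    then obtain d where d: "n = m + Suc d" by blast
    have "\<epsilon> \<le> N (y - f (s d))" unfolding \<epsilon>_def using sK by (intro w(2)) auto
    also have "\<dots> = N (s 0 - s (Suc d))" by (simp add: s_def)
    also have "\<dots> = N (s m - s n)" using shift[of m 0 "Suc d"] d by simp
    finally show ?thesis .
  qed
  obtain l r where r: "strict_mono (r :: nat \<Rightarrow> nat)" "(s \<circ> r) \<longlonglongrightarrow> l"
    using K sK unfolding compact_def by blast
  have "Cauchy (s \<circ> r)" using r(2) LIMSEQ_imp_Cauchy by blast
  then obtain M where M: "\<And>m n. m \<ge> M \<Longrightarrow> n \<ge> M \<Longrightarrow> dist ((s \<circ> r) m) ((s \<circ> r) n) < \<epsilon> / C"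
    using \<epsilon> C(1) unfolding Cauchy_def by (metis divide_pos_pos)
  have "\<epsilon> \<le> N (s (r M) - s (r (Suc M)))" using r(1) by (intro sep) (auto simp: strict_mono_def)
  also have "\<dots> \<le> C * norm (s (r M) - s (r (Suc M)))" using sK by (intro C(2)) (auto simp: K_def)
  also have "\<dots> < \<epsilon>" using M[of M "Suc M"] C(1) by (simp add: dist_norm field_simps)
  finally show False by simp
qed

definition isometry :: "('a \<Rightarrow> 'a) \<Rightarrow> bool" where
  "isometry f \<longleftrightarrow> f ` X = X \<and> (\<forall>x\<in>X. \<forall>y\<in>X. N (f x - f y) = N (x - y))"

lemma isometry_mem: "isometry f \<Longrightarrow> x \<in> X \<Longrightarrow> f x \<in> X"
  and isometry_dist: "isometry f \<Longrightarrow> x \<in> X \<Longrightarrow> y \<in> X \<Longrightarrow> N (f x - f y) = N (x - y)"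
  by (auto simp: isometry_def)

lemma isometry_comp: assumes "isometry f" "isometry g" shows "isometry (g \<circ> f)"
  using assms unfolding isometry_def image_comp[symmetric] by (simp, metis image_eqI)

lemma isometry_inj: assumes "isometry f" shows "inj_on f X"
proof (rule inj_onI)
  fix x y assume xy: "x \<in> X" "y \<in> X" "f x = f y"
  then have "N (x - y) = 0" using isometry_dist[OF assms, of x y] by simp
  then show "x = y" using xy N_eq_0[of "x - y"] by simp
qed

lemma isometry_inv: assumes "isometry f" shows "isometry (inv_into X f)"
  unfolding isometry_def
proof (intro conjI ballI)
  have im: "f ` X = X" using assms by (simp add: isometry_def)
  show "inv_into X f ` X = X"
    using isometry_inj[OF assms] im by (metis inv_into_image_cancel order_refl)
  fix x y assume "x \<in> X" "y \<in> X"
  then show "N (inv_into X f x - inv_into X f y) = N (x - y)"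
    using isometry_dist[OF assms, of "inv_into X f x" "inv_into X f y"] im
    by (simp add: f_inv_into_f inv_into_into)
qed

lemma isometry_reflection: assumes "c \<in> X" shows "isometry (\<lambda>x. c - x)"
  unfolding isometry_def
proof (intro conjI ballI)
  show "(-) c ` X = X"
  proof
    show "X \<subseteq> (-) c ` X"
    proof
      fix x assume "x \<in> X"
      then have "c - (c - x) \<in> (-) c ` X" using assms by (intro imageI) auto
      then show "x \<in> (-) c ` X" by simp
    qed
  qed (use assms in auto)
  fix x y assume "x \<in> X" "y \<in> X"
  then show "N (c - x - (c - y)) = N (x - y)" using N_diff_commute[of x y] by simp
qed

text \<open>
Vaisala's argument for the Mazur-Ulam theorem. The reflection \<open>\<psi>\<close> in the midpoint \<open>z\<close> swaps \<open>a\<close>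
and \<open>b\<close>. If \<open>h\<close> is an isometry that fixes \<open>a\<close> and \<open>b\<close>, with inverse \<open>i\<close>, then \<open>\<psi> i \<psi> h\<close> is another
one, and it moves \<open>z\<close> twice as far. But no isometry fixing \<open>a\<close> moves \<open>z\<close> by more than \<open>2 N (a - z)\<close>.
\<close>

lemma isometry_fixes_midpoint:
  assumes g: "isometry g" and a: "a \<in> X" "b \<in> X" "g a = a" "g b = b"
  shows "g ((1/2) *\<^sub>R (a + b)) = (1/2) *\<^sub>R (a + b)"
proof -
  define z where "z = (1/2) *\<^sub>R (a + b)"
  define \<psi> where "\<psi> x = (a + b) - x" for x
  have \<psi>: "isometry \<psi>" unfolding \<psi>_def using a by (intro isometry_reflection) auto
  have zX: "z \<in> X" using a by (auto simp: z_def)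
  have \<psi>z: "\<psi> z = z" by (simp add: \<psi>_def z_def algebra_simps flip: scaleR_2 scaleR_add_left)
  have dbl: "N (\<psi> x - x) = 2 * N (x - z)" if "x \<in> X" for x
  proof -
    have "\<psi> x - x = (-2) *\<^sub>R (x - z)"
      by (simp add: \<psi>_def z_def algebra_simps scaleR_2 flip: scaleR_add_left)
    then show ?thesis using N_scale[of "x - z" "-2"] that zX by simp
  qed
  have bound: "2 ^ n * N (h z - z) \<le> 2 * N (a - z)"
    if "isometry h" "h a = a" "h b = b" for h n
    using that
  proof (induction n arbitrary: h)
    case 0
    have "N (h z - z) \<le> N (h z - h a) + N (a - z)"
      using N_triangle_diff[of "h z" a z] isometry_mem[OF 0(1) zX] 0 a zX by simp
    then show ?case using isometry_dist[OF 0(1) zX a(1)] N_diff_commute[OF zX a(1)] by simp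
  next
    case (Suc n)
    define i where "i = inv_into X h"
    have i: "isometry i" unfolding i_def by (rule isometry_inv) fact
    have ih: "i (h x) = x" if "x \<in> X" for x
      unfolding i_def using isometry_inj[OF Suc.prems(1)] that by simp
    have ia: "i a = a" "i b = b" using ih[OF a(1)] ih[OF a(2)] Suc.prems by auto
    \<comment> \<open>The isometry \<open>h'\<close> moves \<open>z\<close> twice as far as \<open>h\<close> does.\<close>
    define h' where "h' = \<psi> \<circ> (i \<circ> (\<psi> \<circ> h))"
    have "isometry h'" unfolding h'_def by (intro isometry_comp \<psi> i Suc.prems(1))
    moreover have "h' a = a" "h' b = b" using ia Suc.prems by (auto simp: h'_def \<psi>_def)
    ultimately have "2 ^ n * N (h' z - z) \<le> 2 * N (a - z)" by (rule Suc.IH)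
    moreover have "N (h' z - z) = 2 * N (h z - z)"
    proof -
      have hz: "h z \<in> X" "\<psi> (h z) \<in> X" "i (\<psi> (h z)) \<in> X"
        using isometry_mem[OF Suc.prems(1) zX] isometry_mem[OF \<psi>] isometry_mem[OF i] by auto
      have "N (h' z - z) = N (\<psi> (i (\<psi> (h z))) - \<psi> z)" by (simp add: h'_def \<psi>z)
      also have "\<dots> = N (i (\<psi> (h z)) - i (h z))" using hz zX by (simp add: isometry_dist[OF \<psi>] ih)
      also have "\<dots> = N (\<psi> (h z) - h z)" using hz by (simp add: isometry_dist[OF i])
      finally show ?thesis using dbl hz by simp
    qed
    ultimately show ?case by (simp add: algebra_simps)
  qed
  have "N (g z - z) = 0"
  proof (rule ccontr)
    assume "N (g z - z) \<noteq> 0"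
    moreover have gz: "g z - z \<in> X" using isometry_mem[OF g zX] zX by auto
    ultimately have pos: "N (g z - z) > 0" using N_nonneg[OF gz] by simp
    obtain n where "2 * N (a - z) / N (g z - z) < 2 ^ n" using real_arch_pow[of 2] by auto
    then show False using bound[OF g a(3,4), of n] pos by (simp add: field_simps)
  qed
  then show ?thesis using N_eq_0[of "g z - z"] isometry_mem[OF g zX] zX by (auto simp: z_def)
qed

lemma isometry_midpoint:
  assumes f: "isometry f" and a: "a \<in> X" "b \<in> X"
  shows "f ((1/2) *\<^sub>R (a + b)) = (1/2) *\<^sub>R (f a + f b)"
proof -
  define z where "z = (1/2) *\<^sub>R (a + b)"
  define i where "i = inv_into X f"
  have i: "isometry i" unfolding i_def by (rule isometry_inv) fact
  have fi: "i (f x) = x" if "x \<in> X" for x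
    unfolding i_def using isometry_inj[OF f] that by simp
  have fa: "f a \<in> X" "f b \<in> X" using isometry_mem[OF f] a by auto
  have zX: "z \<in> X" using a by (auto simp: z_def)
  define h where "h = (\<lambda>x. (a + b) - x) \<circ> (i \<circ> ((\<lambda>x. (f a + f b) - x) \<circ> f))"
  have "isometry h" unfolding h_def by (intro isometry_comp isometry_reflection i f) (use a fa in auto)
  moreover have "h a = a" "h b = b" using fi a by (auto simp: h_def)
  ultimately have "h z = z" unfolding z_def using a by (intro isometry_fixes_midpoint) auto
  moreover have "(a + b) - z = z"
    by (simp add: z_def algebra_simps flip: scaleR_2 scaleR_add_left)
  ultimately have "i ((f a + f b) - f z) = z" by (simp add: h_def algebra_simps)
  moreover have "f (i x) = x" if "x \<in> X" for x
    using f that unfolding i_def isometry_def by (simp add: f_inv_into_f)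
  ultimately have "(f a + f b) - f z = f z" using fa isometry_mem[OF f zX] by (metis subspace_mem(2,3))
  then have "f a + f b = 2 *\<^sub>R f z" by (simp add: scaleR_2 algebra_simps)
  then show ?thesis by (simp add: z_def)
qed

text \<open>
The Mazur-Ulam theorem, with surjectivity supplied by compactness. Preservation of midpoints gives
additivity, and an additive isometry is homogeneous over the reals.
\<close>

theorem isometry_linear:
  assumes f: "f ` X \<subseteq> X" and iso: "\<And>x y. x \<in> X \<Longrightarrow> y \<in> X \<Longrightarrow> N (f x - f y) = N (x - y)"
    and f0: "f 0 = 0"
  shows "x \<in> X \<Longrightarrow> y \<in> X \<Longrightarrow> f (x + y) = f x + f y"
    and "x \<in> X \<Longrightarrow> f (r *\<^sub>R x) = r *\<^sub>R f x"
proof -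
  have isom: "isometry f" unfolding isometry_def using isometry_surjective[OF f iso f0] iso by auto
  have half: "f ((1/2) *\<^sub>R x) = (1/2) *\<^sub>R f x" if "x \<in> X" for x
    using isometry_midpoint[OF isom, of x 0] that f0 by simp
  have add: "f (x + y) = f x + f y" if "x \<in> X" "y \<in> X" for x y
  proof -
    have "(1/2) *\<^sub>R f (x + y) = (1/2) *\<^sub>R (f x + f y)"
      using isometry_midpoint[OF isom that] half[of "x + y"] that by simp
    then show ?thesis by simp
  qed
  show "x \<in> X \<Longrightarrow> y \<in> X \<Longrightarrow> f (x + y) = f x + f y" by (rule add)
  assume x: "x \<in> X"
  \<comment> \<open>The defect \<open>D\<close> of homogeneity is additive and periodic, hence bounded, hence zero.\<close>
  define D where "D s = f (s *\<^sub>R x) - s *\<^sub>R f x" for s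
  have DX: "D s \<in> X" for s unfolding D_def using f x by (intro subspace_mem) auto
  have D_add: "D (s + t) = D s + D t" for s t
    using add[of "s *\<^sub>R x" "t *\<^sub>R x"] x by (simp add: D_def scaleR_add_left)
  have D1: "D 1 = 0" by (simp add: D_def)
  have D0: "D 0 = 0" by (simp add: D_def f0)
  have D_nat: "D (real n * s) = real n *\<^sub>R D s" for n s
    by (induction n) (auto simp: D0 D_add algebra_simps)
  have D_int: "D (of_int m) = 0" for m
  proof (cases m)
    case (nonneg n) then show ?thesis using D_nat[of n 1] D1 by simp
  next
    case (neg n)
    have "D (real (Suc n)) = 0" using D_nat[of "Suc n" 1] D1 by simp
    then show ?thesis using D_add[of "real (Suc n)" "of_int m"] D0 neg by simp
  qed
  have D_bound: "N (D s) \<le> 2 * N x" for s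
  proof -
    have fx: "N (f y) = N y" if "y \<in> X" for y using iso[of y 0] that f0 by simp
    have "D s = D (frac s)" using D_add[of "frac s" "of_int \<lfloor>s\<rfloor>"] D_int by (simp add: frac_def)
    also have "N (D (frac s)) \<le> N (f (frac s *\<^sub>R x)) + N (- (frac s *\<^sub>R f x))"
      unfolding D_def using N_triangle[of "f (frac s *\<^sub>R x)" "- (frac s *\<^sub>R f x)"] x f by auto
    also have "\<dots> = 2 * (frac s * N x)"
      using x f frac_ge_0[of s] by (simp add: N_minus N_scale fx image_subset_iff)
    also have "\<dots> \<le> 2 * N x" using frac_lt_1[of s] N_nonneg[OF x] by (simp add: mult_left_le_one_le)
    finally show ?thesis .
  qed
  have "N (D r) = 0"
  proof (rule ccontr)
    assume "N (D r) \<noteq> 0"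
    then have pos: "N (D r) > 0" using N_nonneg[OF DX] by (simp add: less_le)
    obtain n where "2 * N x / N (D r) < real n" using reals_Archimedean2 by blast
    moreover have "real n * N (D r) \<le> 2 * N x"
      using D_bound[of "real n * r"] by (simp add: D_nat N_scale DX)
    ultimately show False using pos by (simp add: field_simps)
  qed
  then show "f (r *\<^sub>R x) = r *\<^sub>R f x" using N_eq_0[OF DX] by (simp add: D_def)
qed

subsection \<open>Smooth points\<close>

text \<open>
Support functionals are represented by vectors of \<open>X\<close> through the inner product. The Hahn-Banach
theorem becomes the separation of \<open>x\<close> from the open ball of radius \<open>N x\<close>; the separating vector is
a direction of the affine hull of these, so it lies in \<open>X\<close> and is not constant on \<open>X\<close>.
\<close>

lemma support_vector_exists:
  assumes x: "x \<in> X" "x \<noteq> 0"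
  obtains a where "a \<in> X" "\<And>y. y \<in> X \<Longrightarrow> a \<bullet> y \<le> N y" "a \<bullet> x = N x"
proof -
  define S where "S = {y \<in> X. N y < N x}"
  have Nx: "N x > 0" using x by (rule N_pos)
  have "convex S"
  proof (rule convexI)
    fix y z u v assume yz: "y \<in> S" "z \<in> S" and uv: "0 \<le> u" "0 \<le> v" "u + v = (1::real)"
    have "N (u *\<^sub>R y + v *\<^sub>R z) \<le> u * N y + v * N z"
      using N_triangle[of "u *\<^sub>R y" "v *\<^sub>R z"] yz uv by (auto simp: S_def N_scale)
    also have "\<dots> < N x" using yz uv convex_bound_lt[of "N y" "N x" "N z" u v] by (auto simp: S_def)
    finally show "u *\<^sub>R y + v *\<^sub>R z \<in> S" using yz by (auto simp: S_def)
  qed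
  moreover have "0 \<in> S" using Nx by (auto simp: S_def)
  moreover have "x \<notin> S" by (simp add: S_def)
  ultimately obtain a' b where a': "x + a' \<in> affine hull (insert x S)" "a' \<noteq> 0" "a' \<bullet> x \<le> b"
    "\<And>y. y \<in> S \<Longrightarrow> a' \<bullet> y \<ge> b"
    using separating_hyperplane_set_point_inaff[of S x] by blast
  have "affine hull (insert x S) \<subseteq> X"
    using x by (intro hull_minimal subspace_imp_affine subspace) (auto simp: S_def)
  then have "x + a' \<in> X" using a'(1) by auto
  then have aX: "a' \<in> X" using x subspace_mem(3)[of "x + a'" x] by simp
  define a where "a = - a'"
  have a: "a \<in> X" "a \<noteq> 0" "\<And>y. y \<in> S \<Longrightarrow> a \<bullet> y \<le> a \<bullet> x"
    using aX a' by (auto simp: a_def intro: order_trans)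
  have pos: "a \<bullet> x > 0"
  proof -
    \<comment> \<open>A small multiple of \<open>a\<close> lies in the ball, which forces \<open>a \<bullet> x\<close> to be positive.\<close>
    define e where "e = N x / (2 * N a)"
    have Na: "N a > 0" using a by (intro N_pos)
    have e: "e > 0" using Na Nx by (simp add: e_def)
    have "e *\<^sub>R a \<in> S" using a Na Nx e by (simp add: S_def N_scale) (simp add: e_def)
    then have "e * (a \<bullet> a) \<le> a \<bullet> x" using a(3) by fastforce
    moreover have "e * (a \<bullet> a) > 0" using e a by simp
    ultimately show ?thesis by linarith
  qed
  have main: "a \<bullet> y * N x \<le> (a \<bullet> x) * N y" if y: "y \<in> X" for y
  proof (cases "y = 0")
    case False
    have Ny: "N y > 0" using y False by (rule N_pos)
    have *: "r * (a \<bullet> y) \<le> a \<bullet> x" if r: "0 < r" "r < N x / N y" for r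
    proof -
      have "r *\<^sub>R y \<in> S" using y r Ny by (simp add: S_def N_scale field_simps)
      then show ?thesis using a(3)[of "r *\<^sub>R y"] by simp
    qed
    show ?thesis
    proof (rule ccontr)
      assume "\<not> a \<bullet> y * N x \<le> (a \<bullet> x) * N y"
      then have lt: "(a \<bullet> x) * N y < a \<bullet> y * N x" by simp
      then have "0 < a \<bullet> y * N x" using pos Ny by (smt (verit) mult_pos_pos)
      then have ay: "a \<bullet> y > 0" using Nx by (simp add: zero_less_mult_iff)
      have "(a \<bullet> x) / (a \<bullet> y) < N x / N y" using lt ay Ny by (simp add: field_simps)
      then obtain r where r: "(a \<bullet> x) / (a \<bullet> y) < r" "r < N x / N y" using dense by blast
      moreover have "r > 0" using r(1) pos ay by (smt (verit) divide_pos_pos)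
      ultimately show False using *[of r] ay by (simp add: field_simps)
    qed
  qed simp
  define g where "g = (N x / (a \<bullet> x)) *\<^sub>R a"
  have "g \<in> X" using a by (auto simp: g_def)
  moreover have "g \<bullet> y \<le> N y" if "y \<in> X" for y using main[OF that] pos by (simp add: g_def field_simps)
  moreover have "g \<bullet> x = N x" using pos by (simp add: g_def)
  ultimately show thesis using that by blast
qed

lemma support_functional_of_vector:
  assumes x: "x \<in> X" "x \<noteq> 0" and a: "\<And>y. y \<in> X \<Longrightarrow> a \<bullet> y \<le> N y" "a \<bullet> x = N x"
  shows "support_functional X N (x /\<^sub>R N x) (restrict (\<lambda>y. a \<bullet> y) X)"
proof -
  have "N x > 0" using x by (rule N_pos)
  moreover have "\<bar>a \<bullet> y\<bar> \<le> N y" if "y \<in> X" for y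
    using a(1)[of y] a(1)[of "- y"] that by (auto simp: N_minus)
  ultimately show ?thesis
    unfolding support_functional_def real_linear_on_def
    using x a by (auto simp: inner_add_right)
qed

text \<open>
Uniqueness of the support functional \<open>a\<close> makes it the derivative of the norm: the difference quotient
at \<open>x\<close> in direction \<open>h\<close> lies between \<open>a \<bullet> h\<close> and \<open>b \<bullet> h\<close>, where \<open>b\<close> supports at \<open>x + t h\<close>, and by
compactness such \<open>b\<close> are close to \<open>a\<close> at \<open>h\<close> when \<open>t\<close> is small. What matters below is that the derivative is linear in \<open>h\<close>.
\<close>

theorem smooth_imp_Gateaux:
  assumes x: "x \<in> X" and sm: "smooth_at X N x"
  obtains a where "\<And>h. h \<in> X \<Longrightarrow> ((\<lambda>t. (1 / t) * (N (x + t *\<^sub>R h) - N x)) \<longlongrightarrow> a \<bullet> h) (at 0)"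
proof -
  have x0: "x \<noteq> 0" using sm by (simp add: smooth_at_def)
  have Nx: "N x > 0" using x x0 by (rule N_pos)
  obtain C where C: "C > 0" "\<And>x. x \<in> X \<Longrightarrow> N x \<le> C * norm x" using N_upper by blast
  obtain a where a: "a \<in> X" "\<And>y. y \<in> X \<Longrightarrow> a \<bullet> y \<le> N y" "a \<bullet> x = N x"
    using support_vector_exists[OF x x0] by blast
  have uniq: "b \<bullet> h = a \<bullet> h"
    if "\<And>y. y \<in> X \<Longrightarrow> b \<bullet> y \<le> N y" "b \<bullet> x = N x" "h \<in> X" for b h
  proof -
    have "restrict ((\<bullet>) a) X = restrict ((\<bullet>) b) X"
      using sm support_functional_of_vector[OF x x0 a(2,3)] support_functional_of_vector[OF x x0 that(1,2)]
      unfolding smooth_at_def by auto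
    then show ?thesis using that(3) by (metis restrict_apply')
  qed
  have "((\<lambda>t. (1 / t) * (N (x + t *\<^sub>R h) - N x)) \<longlongrightarrow> a \<bullet> h) (at 0)" if h: "h \<in> X" for h
  proof (rule tendstoI)
    fix \<epsilon> :: real assume \<epsilon>: "\<epsilon> > 0"
    \<comment> \<open>Support functionals that differ from \<open>a\<close> at \<open>h\<close> by at least \<open>\<epsilon>\<close>.\<close>
    define K where "K = {b \<in> X. (\<forall>y\<in>X. b \<bullet> y \<le> N y) \<and> \<epsilon> \<le> \<bar>b \<bullet> h - a \<bullet> h\<bar>}"
    have "bounded K"
    proof (rule boundedI)
      fix b assume "b \<in> K"
      then have "b \<bullet> b \<le> C * norm b" using C(2)[of b] by (auto simp: K_def intro: order_trans)
      then have "norm b * norm b \<le> C * norm b" by (simp add: dot_square_norm power2_eq_square)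
      then show "norm b \<le> C" using C(1) by (cases "norm b = 0") auto
    qed
    moreover have "K = X \<inter> (\<Inter>y\<in>X. {b. b \<bullet> y \<le> N y}) \<inter> {b. \<epsilon> \<le> \<bar>b \<bullet> h - a \<bullet> h\<bar>}"
      by (auto simp: K_def)
    then have "closed K"
      using closed_subspace[OF subspace]
      by (auto intro!: closed_Int closed_INT closed_Collect_le continuous_intros)
    ultimately have K: "compact K" by (simp add: compact_eq_bounded_closed)
    obtain \<delta> where \<delta>: "\<delta> > 0" "\<And>b. b \<in> K \<Longrightarrow> \<delta> \<le> N x - b \<bullet> x"
    proof (cases "K = {}")
      case False
      obtain b where b: "b \<in> K" "\<And>c. c \<in> K \<Longrightarrow> N x - b \<bullet> x \<le> N x - c \<bullet> x"
        using continuous_attains_inf[OF K False, of "\<lambda>b. N x - b \<bullet> x"]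
        by (force intro: continuous_intros)
      have "b \<bullet> x \<noteq> N x" using uniq[of b h] b(1) h \<epsilon> by (auto simp: K_def)
      then have "N x - b \<bullet> x > 0" using b(1) x by (force simp: K_def)
      then show thesis using that b by blast
    qed (use that[of 1] in auto)
    \<comment> \<open>The first bound makes \<open>N x - b \<bullet> x \<le> 2 \<bar>t\<bar> N h\<close> smaller than \<open>\<delta>\<close>, the second keeps \<open>x + t h\<close> away from \<open>0\<close>.\<close>
    define d where "d = min (\<delta> / (2 * N h + 1)) (N x / (N h + 1))"
    have Nh: "N h \<ge> 0" using h by (rule N_nonneg)
    have d: "d > 0" using \<delta> Nx Nh by (simp add: d_def)
    have "dist ((1 / t) * (N (x + t *\<^sub>R h) - N x)) (a \<bullet> h) < \<epsilon>" if t: "t \<noteq> 0" "\<bar>t\<bar> < d" for t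
    proof -
      let ?y = "x + t *\<^sub>R h"
      have y: "?y \<in> X" using x h by auto
      have Nth: "N (t *\<^sub>R h) = \<bar>t\<bar> * N h" using h by (simp add: N_scale)
      have "\<bar>t\<bar> * (N h + 1) < N x" using t Nh by (simp add: d_def field_simps)
      moreover have "\<bar>t\<bar> * (N h + 1) = \<bar>t\<bar> * N h + \<bar>t\<bar>" by (simp add: algebra_simps)
      ultimately have "\<bar>t\<bar> * N h < N x" by linarith
      then have "?y \<noteq> 0" using N_minus[of "t *\<^sub>R h"] h Nth by (metis add_eq_0_iff2 less_irrefl subspace_mem(4))
      then obtain b where b: "b \<in> X" "\<And>z. z \<in> X \<Longrightarrow> b \<bullet> z \<le> N z" "b \<bullet> ?y = N ?y"
        using support_vector_exists[OF y] by blast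
      have "\<bar>b \<bullet> (t *\<^sub>R h)\<bar> \<le> \<bar>t\<bar> * N h"
        using b(2)[of "t *\<^sub>R h"] b(2)[of "- (t *\<^sub>R h)"] h Nth N_minus[of "t *\<^sub>R h"] by auto
      moreover have "N x - N ?y \<le> \<bar>t\<bar> * N h" using N_diff_bound[OF x y] Nth h by (simp add: N_minus)
      moreover have "N x - b \<bullet> x = N x - N ?y + b \<bullet> (t *\<^sub>R h)"
        using b(3) by (simp add: inner_add_right)
      moreover have "\<bar>t\<bar> * (2 * N h + 1) < \<delta>" using t Nh by (simp add: d_def field_simps)
      moreover have "\<bar>t\<bar> * (2 * N h + 1) = \<bar>t\<bar> * N h + \<bar>t\<bar> * N h + \<bar>t\<bar>" by (simp add: algebra_simps)
      ultimately have "N x - b \<bullet> x < \<delta>" by linarith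
      then have bK: "\<bar>b \<bullet> h - a \<bullet> h\<bar> < \<epsilon>" using \<delta>(2)[of b] b unfolding K_def by force
      have lo: "t * (a \<bullet> h) \<le> N ?y - N x" using a(2)[OF y] a(3) by (simp add: inner_add_right)
      have hi: "N ?y - N x \<le> t * (b \<bullet> h)" using b(2)[OF x] b(3) by (simp add: inner_add_right)
      have "\<bar>(1 / t) * (N ?y - N x) - a \<bullet> h\<bar> \<le> \<bar>b \<bullet> h - a \<bullet> h\<bar>"
      proof (cases "t > 0")
        case True
        then have "a \<bullet> h \<le> (1 / t) * (N ?y - N x)" "(1 / t) * (N ?y - N x) \<le> b \<bullet> h"
          using lo hi by (simp_all add: field_simps)
        then show ?thesis by linarith
      next
        case False
        then have "t < 0" using t by simp
        then have "a \<bullet> h \<ge> (1 / t) * (N ?y - N x)" "(1 / t) * (N ?y - N x) \<ge> b \<bullet> h"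
          using lo hi by (simp_all add: field_simps)
        then show ?thesis by linarith
      qed
      then show ?thesis using bK by (simp add: dist_real_def)
    qed
    then show "\<forall>\<^sub>F t in at 0. dist ((1 / t) * (N (x + t *\<^sub>R h) - N x)) (a \<bullet> h) < \<epsilon>"
      unfolding eventually_at using d by (intro exI[of _ d]) (auto simp: dist_real_def)
  qed
  then show thesis using that by blast
qed

end

section \<open>Matrices over the reals and the complex numbers\<close>

type_synonym 'n cmat = "complex^'n^'n"

lemma matmul_bilinear: "bounded_bilinear ((**) :: 'n::finite cmat \<Rightarrow> 'n cmat \<Rightarrow> 'n cmat)"
  unfolding bilinear_conv_bounded_bilinear[symmetric] bilinear_def linear_iff
  by (auto simp: vec_eq_iff matrix_matrix_mult_def distrib_left distrib_right sum.distrib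
      scaleR_sum_right)

interpretation matmul: bounded_bilinear "(**) :: 'n::finite cmat \<Rightarrow> 'n cmat \<Rightarrow> 'n cmat"
  by (rule matmul_bilinear)

lemma conj_transpose_linear: "bounded_linear (conj_transpose :: 'n::finite cmat \<Rightarrow> _)"
  unfolding linear_conv_bounded_linear[symmetric] linear_iff
  by (auto simp: vec_eq_iff conj_transpose_def)

lemmas ct_add = linear_add [OF bounded_linear.linear [OF conj_transpose_linear]]
  and ct_diff = linear_diff [OF bounded_linear.linear [OF conj_transpose_linear]]
  and ct_scaleR = linear_scale [OF bounded_linear.linear [OF conj_transpose_linear]]

lemma ct_ct [simp]: "conj_transpose (conj_transpose a) = a"
  by (simp add: conj_transpose_def vec_eq_iff)

lemma ct_mult: "conj_transpose (a ** b) = conj_transpose b ** conj_transpose a"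
  by (simp add: conj_transpose_def matrix_matrix_mult_def vec_eq_iff mult.commute)

lemma ct_mat: "conj_transpose (mat c) = mat (cnj c)"
  by (auto simp: conj_transpose_def mat_def vec_eq_iff)

lemma ct_one [simp]: "conj_transpose (mat 1) = mat 1"
  by (simp add: ct_mat)

lemma ct_nth: "conj_transpose a $ i $ j = cnj (a $ j $ i)"
  by (simp add: conj_transpose_def)

lemma mat_mult_nth: "(mat c ** a) $ i $ j = c * a $ i $ j" for a :: "'n::finite cmat"
  by (simp add: matrix_matrix_mult_def mat_def if_distrib [of "\<lambda>x. x * _"] cong: if_cong)

lemma mult_mat_nth: "(a ** mat c) $ i $ j = c * a $ i $ j" for a :: "'n::finite cmat"
  by (simp add: matrix_matrix_mult_def mat_def if_distrib [of "\<lambda>x. _ * x"] mult.commute cong: if_cong)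

lemma mat_commute: "a ** mat c = mat c ** a" for a :: "'n::finite cmat"
  by (simp add: vec_eq_iff mat_mult_nth mult_mat_nth)

lemma matrix_unit_mult_nth: "(matrix_unit i j ** a) $ r $ s = (if r = i then a $ j $ s else 0)"
  for a :: "'n::finite cmat"
  by (simp add: matrix_matrix_mult_def matrix_unit_def if_distrib [of "\<lambda>x. x * _"] cong: if_cong)

lemma mult_matrix_unit_nth: "(a ** matrix_unit i j) $ r $ s = (if s = j then a $ r $ i else 0)"
  for a :: "'n::finite cmat"
  by (simp add: matrix_matrix_mult_def matrix_unit_def if_distrib [of "\<lambda>x. _ * x"] cong: if_cong)

lemma mult_zero_matrix [simp]: "a ** 0 = 0" "0 ** a = 0" for a :: "'n::finite cmat"
  by (simp_all add: matmul.zero_left matmul.zero_right)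

lemma norm_unitary:
  fixes u :: "'n::finite cmat"
  assumes "u ** conj_transpose u = mat 1"
  shows "norm u = sqrt CARD('n)"
proof -
  have "(norm (u $ i))\<^sup>2 = 1" for i
  proof -
    have "complex_of_real ((norm (u $ i))\<^sup>2) = (\<Sum>j\<in>UNIV. of_real ((norm (u $ i $ j))\<^sup>2))"
      by (simp add: norm_vec_def L2_set_def sum_nonneg)
    also have "\<dots> = (u ** conj_transpose u) $ i $ i"
      by (simp add: matrix_matrix_mult_def ct_nth complex_norm_square flip: of_real_power)
    also have "\<dots> = 1" using assms by (simp add: mat_def)
    finally show ?thesis by (metis of_real_eq_1_iff)
  qed
  then show ?thesis by (simp add: norm_vec_def L2_set_def)
qed

locale matrix_field =
  fixes F :: "complex set"
  assumes F: "F = \<real> \<or> F = UNIV"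
begin

lemma F_closed:
  "0 \<in> F" "1 \<in> F" "of_real r \<in> F" "x \<in> F \<Longrightarrow> y \<in> F \<Longrightarrow> x + y \<in> F" "x \<in> F \<Longrightarrow> y \<in> F \<Longrightarrow> x * y \<in> F"
  "x \<in> F \<Longrightarrow> r *\<^sub>R x \<in> F" "x \<in> F \<Longrightarrow> cnj x \<in> F" "x \<in> F \<Longrightarrow> - x \<in> F"
  using F by (auto simp: Reals_cnj_iff scaleR_conv_of_real)

lemma F_sum: "(\<And>i. i \<in> I \<Longrightarrow> f i \<in> F) \<Longrightarrow> sum f I \<in> F"
  using F by (auto intro: sum_in_Reals)

lemma subspace_matrices: "subspace (matrices F :: 'n::finite cmat set)"
  unfolding subspace_def matrices_def by (auto simp: F_closed)

lemma mat_matrices: "c \<in> F \<Longrightarrow> mat c \<in> matrices F"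
  by (auto simp: matrices_def mat_def F_closed)

lemma one_matrices: "mat 1 \<in> matrices F"
  by (simp add: mat_matrices F_closed)

lemma mult_matrices: "a \<in> matrices F \<Longrightarrow> b \<in> matrices F \<Longrightarrow> a ** b \<in> matrices F"
  by (auto simp: matrices_def matrix_matrix_mult_def intro!: F_sum F_closed)

lemma ct_matrices: "a \<in> matrices F \<Longrightarrow> conj_transpose a \<in> matrices F"
  by (auto simp: matrices_def ct_nth F_closed)

lemma matrix_unit_matrices: "matrix_unit i j \<in> matrices F"
  by (auto simp: matrices_def matrix_unit_def F_closed)

lemma one_unitary: "mat 1 \<in> unitary_matrices F"
  by (simp add: unitary_matrices_def one_matrices)

lemma ct_unitary: "u \<in> unitary_matrices F \<Longrightarrow> conj_transpose u \<in> unitary_matrices F"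
  by (simp add: unitary_matrices_def ct_matrices)

lemma unitaryD:
  assumes "u \<in> unitary_matrices F"
  shows "u \<in> matrices F" "u ** conj_transpose u = mat 1" "conj_transpose u ** u = mat 1"
  using assms by (auto simp: unitary_matrices_def)

lemma mult_unitary:
  assumes u: "u \<in> unitary_matrices F" and w: "w \<in> unitary_matrices F"
  shows "u ** w \<in> unitary_matrices F"
proof -
  have "(u ** w) ** conj_transpose (u ** w) = u ** (w ** conj_transpose w) ** conj_transpose u"
    by (simp add: ct_mult matrix_mul_assoc)
  moreover have "conj_transpose (u ** w) ** (u ** w) = conj_transpose w ** (conj_transpose u ** u) ** w"
    by (simp add: ct_mult matrix_mul_assoc)
  ultimately show ?thesis
    using unitaryD[OF u] unitaryD[OF w] by (auto simp: unitary_matrices_def mult_matrices)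
qed

lemma compact_unitary: "compact (unitary_matrices F :: 'n::finite cmat set)"
proof -
  have "closed {u :: 'n cmat. u ** conj_transpose u = mat 1}"
    "closed {u :: 'n cmat. conj_transpose u ** u = mat 1}"
    by (intro closed_Collect_eq continuous_intros matmul.continuous_on bounded_linear.continuous_on[OF conj_transpose_linear])+
  moreover have "(unitary_matrices F :: 'n cmat set) = matrices F \<inter>
      {u. u ** conj_transpose u = mat 1} \<inter> {u. conj_transpose u ** u = mat 1}"
    by (auto simp: unitary_matrices_def)
  ultimately have "closed (unitary_matrices F :: 'n cmat set)"
    by (simp add: closed_Int closed_subspace subspace_matrices)
  moreover have "bounded (unitary_matrices F :: 'n cmat set)"
    by (rule boundedI[of _ "sqrt CARD('n)"]) (auto simp: norm_unitary unitary_matrices_def)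
  ultimately show ?thesis by (simp add: compact_eq_bounded_closed)
qed

definition skew :: "'n::finite cmat set" where
  "skew = {a \<in> matrices F. conj_transpose a = - a}"

lemma subspace_skew: "subspace (skew :: 'n::finite cmat set)"
  using subspace_matrices by (auto simp: subspace_def skew_def ct_add ct_scaleR vec_eq_iff)
   (simp add: ct_nth)

subsection \<open>Paths of unitary matrices\<close>

text \<open>
The quadratic form of a skew-hermitian matrix is purely imaginary, so \<open>s x = x\<close> forces the squared
length of \<open>x\<close> to be both real and imaginary.
\<close>

lemma skew_kernel:
  fixes s :: "'n::finite cmat"
  assumes s: "conj_transpose s = - s" and x: "s *v x = x"
  shows "x = 0"
proof -
  have sk: "cnj (s $ i $ j) = - s $ j $ i" for i j
  proof -
    have "conj_transpose s $ j $ i = (- s) $ j $ i" using s by simp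
    then show ?thesis by (simp add: ct_nth)
  qed
  define h where "h = (\<Sum>i\<in>UNIV. cnj (x $ i) * x $ i)"
  have h: "h = (\<Sum>i\<in>UNIV. \<Sum>j\<in>UNIV. cnj (x $ i) * s $ i $ j * x $ j)"
  proof -
    have "h = (\<Sum>i\<in>UNIV. cnj (x $ i) * (s *v x) $ i)" by (simp add: h_def x)
    then show ?thesis by (simp add: matrix_vector_mult_def sum_distrib_left mult.assoc)
  qed
  have "cnj h = (\<Sum>i\<in>UNIV. \<Sum>j\<in>UNIV. - (cnj (x $ j) * s $ j $ i * x $ i))"
    by (subst h) (simp add: sk algebra_simps)
  also have "\<dots> = - h" by (subst sum.swap) (simp add: h sum_negf)
  finally have "cnj h = - h" .
  moreover have hr: "h = of_real (\<Sum>i\<in>UNIV. (cmod (x $ i))\<^sup>2)"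
    by (simp add: h_def complex_norm_square mult.commute flip: of_real_power)
  ultimately have "h + h = 0" by simp
  then have "h = 0" by (simp flip: mult_2)
  then have "(\<Sum>i\<in>UNIV. (cmod (x $ i))\<^sup>2) = 0" using hr of_real_eq_0_iff by metis
  then have "\<forall>i. x $ i = 0" by (subst (asm) sum_nonneg_eq_0_iff) auto
  then show ?thesis by (simp add: vec_eq_iff)
qed

text \<open>
For skew-hermitian \<open>s\<close> and \<open>R\<close> the inverse of \<open>1 - s\<close>, the matrix \<open>2 R - 1\<close> is the Cayley transform
\<open>(1 + s) R\<close>. Over the reals, \<open>R\<close> is real because its entrywise conjugate is an inverse too.
\<close>

lemma skew_resolvent:
  assumes s: "s \<in> skew"
  obtains R where "R \<in> matrices F" "(mat 1 - s) ** R = mat 1" "R ** (mat 1 - s) = mat 1"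
    "2 *\<^sub>R R - mat 1 \<in> unitary_matrices F"
proof -
  have sk: "conj_transpose s = - s" and sF: "s \<in> matrices F" using s by (auto simp: skew_def)
  have "\<forall>x. (mat 1 - s) *v x = 0 \<longrightarrow> x = 0"
    using skew_kernel[OF sk] by (auto simp: matrix_vector_mult_diff_rdistrib)
  then obtain R where R: "R ** (mat 1 - s) = mat 1"
    using matrix_left_invertible_ker[of "mat 1 - s"] by blast
  then have R': "(mat 1 - s) ** R = mat 1" using matrix_left_right_inverse by blast
  have RF: "R \<in> matrices F"
  proof (cases "F = \<real>")
    case True
    define cj :: "'a cmat \<Rightarrow> 'a cmat" where "cj a = (\<chi> i j. cnj (a $ i $ j))" for a
    have cj_mult: "cj (a ** b) = cj a ** cj b" for a b
      by (simp add: cj_def matrix_matrix_mult_def vec_eq_iff)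
    have real: "a \<in> matrices F \<longleftrightarrow> cj a = a" for a
      by (auto simp: matrices_def cj_def vec_eq_iff True Reals_cnj_iff)
    have "mat 1 - s \<in> matrices F" by (intro subspace_diff subspace_matrices one_matrices sF)
    then have "cj R ** (mat 1 - s) = cj (R ** (mat 1 - s))" by (simp add: cj_mult real)
    also have "\<dots> = mat 1" using R one_matrices real by metis
    finally have "cj R ** (mat 1 - s) ** R = R" by simp
    then have "cj R = R" using R' by (simp flip: matrix_mul_assoc)
    then show ?thesis by (simp add: real)
  qed (use F in \<open>auto simp: matrices_def\<close>)
  define R2 where "R2 = conj_transpose R"
  have c1: "conj_transpose (mat 1 - s) = mat 1 + s" by (simp add: ct_diff sk)
  have Q: "(mat 1 + s) ** R2 = mat 1" "R2 ** (mat 1 + s) = mat 1"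
    unfolding R2_def c1[symmetric] ct_mult[symmetric] using R R' by simp_all
  have two: "(mat 1 + s) + (mat 1 - s) = 2 *\<^sub>R mat 1" by (simp add: scaleR_2)
  have sum: "a ** (mat 1 + s) ** b + a ** (mat 1 - s) ** b = 2 *\<^sub>R (a ** b)" for a b :: "'a cmat"
    by (simp only: matmul.add_left[symmetric] matmul.add_right[symmetric] two
        matmul.scaleR_right matmul.scaleR_left matrix_mul_rid)
  have RR: "R + R2 = 2 *\<^sub>R (R ** R2)"
    using sum[of R R2] R Q by (simp flip: matrix_mul_assoc add: R)
  have "R2 ** (mat 1 - s) ** R = R2" by (simp add: R' flip: matrix_mul_assoc)
  then have RR': "R + R2 = 2 *\<^sub>R (R2 ** R)" using sum[of R2 R] by (simp add: Q(2))
  define u where "u = 2 *\<^sub>R R - mat 1"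
  have cu: "conj_transpose u = 2 *\<^sub>R R2 - mat 1" by (simp add: u_def R2_def ct_diff ct_scaleR)
  have "u ** conj_transpose u = 2 *\<^sub>R (2 *\<^sub>R (R ** R2) - (R + R2)) + mat 1"
    unfolding cu unfolding u_def
    by (simp add: matmul.diff_left matmul.diff_right matmul.scaleR_left matmul.scaleR_right
        algebra_simps)
  moreover have "conj_transpose u ** u = 2 *\<^sub>R (2 *\<^sub>R (R2 ** R) - (R + R2)) + mat 1"
    unfolding cu unfolding u_def
    by (simp add: matmul.diff_left matmul.diff_right matmul.scaleR_left matmul.scaleR_right
        algebra_simps)
  moreover have "u \<in> matrices F" unfolding u_def
    by (intro subspace_diff subspace_scale subspace_matrices one_matrices RF)
  ultimately have "u \<in> unitary_matrices F" using RR RR' by (auto simp: unitary_matrices_def)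
  then show thesis using that RF R R' u_def by blast
qed

text \<open>
Only the velocity at \<open>0\<close> counts for a rigid motion, so the Cayley transforms of \<open>(t/2) a\<close> serve as well
as the one-parameter group generated by \<open>a\<close>. Their boundedness as unitary matrices bounds the
resolvents \<open>R t\<close>, and the resolvent identity then gives continuity and the derivative.
\<close>

lemma unitary_path:
  assumes a: "a \<in> skew"
  obtains u where "\<And>t. u t \<in> unitary_matrices F" "u 0 = mat 1" "continuous_on UNIV u"
    "(u has_vector_derivative a) (at 0)"
proof -
  have "\<forall>t. \<exists>R. R \<in> matrices F \<and> (mat 1 - (t/2) *\<^sub>R a) ** R = mat 1 \<and> R ** (mat 1 - (t/2) *\<^sub>R a) = mat 1
    \<and> 2 *\<^sub>R R - mat 1 \<in> unitary_matrices F"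
  proof
    fix t :: real
    have "(t/2) *\<^sub>R a \<in> skew"
      using a subspace_scale[OF subspace_matrices, of a] by (auto simp: skew_def ct_scaleR)
    from skew_resolvent[OF this] show "\<exists>R. R \<in> matrices F \<and> (mat 1 - (t/2) *\<^sub>R a) ** R = mat 1 \<and>
      R ** (mat 1 - (t/2) *\<^sub>R a) = mat 1 \<and> 2 *\<^sub>R R - mat 1 \<in> unitary_matrices F" by blast
  qed
  then obtain R where R: "\<And>t. (mat 1 - (t/2) *\<^sub>R a) ** R t = mat 1"
    "\<And>t. R t ** (mat 1 - (t/2) *\<^sub>R a) = mat 1" "\<And>t. 2 *\<^sub>R R t - mat 1 \<in> unitary_matrices F"
    by metis
  define u where "u t = 2 *\<^sub>R R t - mat 1" for t
  have uU: "u t \<in> unitary_matrices F" for t using R(3) by (simp add: u_def)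
  have Ru: "R t = (1/2) *\<^sub>R (u t + mat 1)" for t by (simp add: u_def)
  have R0: "R 0 = mat 1" using R(1)[of 0] by simp
  have diff: "R t - R s = ((t - s)/2) *\<^sub>R (R t ** a ** R s)" for t s
  proof -
    have "R t ** ((mat 1 - (s/2) *\<^sub>R a) - (mat 1 - (t/2) *\<^sub>R a)) ** R s
        = R t ** ((mat 1 - (s/2) *\<^sub>R a) ** R s) - (R t ** (mat 1 - (t/2) *\<^sub>R a)) ** R s"
      by (simp add: matmul.diff_right matmul.diff_left matrix_mul_assoc)
    also have "\<dots> = R t - R s" by (simp add: R)
    also have "(mat 1 - (s/2) *\<^sub>R a) - (mat 1 - (t/2) *\<^sub>R a) = ((t - s)/2) *\<^sub>R a"
      by (simp add: algebra_simps diff_divide_distrib)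
    finally show ?thesis by (simp add: matmul.scaleR_right matmul.scaleR_left)
  qed
  have "\<exists>K>0. \<forall>(x :: 'a cmat) (y :: 'a cmat). norm (x ** y) \<le> norm x * norm y * K"
    by (rule matmul.pos_bounded)
  then obtain K where K: "K > 0" "\<And>(x :: 'a cmat) (y :: 'a cmat). norm (x ** y) \<le> norm x * norm y * K" by auto
  define M where "M = (sqrt CARD('a) + norm (mat 1 :: 'a cmat)) / 2"
  have RM: "norm (R t) \<le> M" for t
    using norm_triangle_ineq[of "u t" "mat 1"] norm_unitary[of "u t"] unitaryD[OF uU[of t]]
    by (simp add: Ru M_def)
  have M0: "M \<ge> 0" using order_trans[OF norm_ge_zero RM] .
  have lip: "dist (R t) (R s) \<le> (M * norm a * K * M * K / 2) * dist t s" for t s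
  proof -
    have "norm (R t ** a ** R s) \<le> norm (R t ** a) * norm (R s) * K" by (rule K)
    also have "\<dots> \<le> (norm (R t) * norm a * K) * norm (R s) * K"
      using K by (intro mult_right_mono) auto
    also have "\<dots> \<le> (M * norm a * K) * M * K"
      using K RM M0 by (intro mult_mono mult_nonneg_nonneg) auto
    finally have "\<bar>t - s\<bar> / 2 * norm (R t ** a ** R s) \<le> \<bar>t - s\<bar> / 2 * ((M * norm a * K) * M * K)"
      by (rule mult_left_mono) simp
    then show ?thesis by (simp add: dist_norm diff mult.commute)
  qed
  have contR: "continuous_on UNIV R"
    by (rule lipschitz_on_continuous_on[of "M * norm a * K * M * K / 2"])
       (use lip M0 K in \<open>auto intro!: lipschitz_onI\<close>)
  have "(R has_vector_derivative (1/2) *\<^sub>R a) (at 0)"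
    unfolding has_vector_derivative_def has_derivative_at
  proof (intro conjI bounded_linear_scaleR_left)
    have "R \<midarrow>0\<rightarrow> R 0" using contR by (simp add: continuous_on_def)
    then have "(\<lambda>h. norm ((1/2) *\<^sub>R (R h ** a) - (1/2) *\<^sub>R a)) \<midarrow>0\<rightarrow> norm ((1/2) *\<^sub>R (R 0 ** a) - (1/2) *\<^sub>R a)"
      by (intro tendsto_intros matmul.tendsto)
    then have "(\<lambda>h. norm ((1/2) *\<^sub>R (R h ** a) - (1/2) *\<^sub>R a)) \<midarrow>0\<rightarrow> 0" by (simp add: R0)
    moreover have "\<forall>\<^sub>F h in at 0. norm ((1/2) *\<^sub>R (R h ** a) - (1/2) *\<^sub>R a) =
      norm (R (0 + h) - R 0 - h *\<^sub>R (1/2) *\<^sub>R a) / norm h"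
      unfolding eventually_at
    proof (intro exI[of _ 1] conjI ballI impI)
      fix h :: real assume h: "h \<noteq> 0 \<and> dist h 0 < 1"
      have "R (0 + h) - R 0 - h *\<^sub>R (1/2) *\<^sub>R a = h *\<^sub>R ((1/2) *\<^sub>R (R h ** a) - (1/2) *\<^sub>R a)"
        using diff[of h 0] by (simp add: R0 scaleR_diff_right)
      then show "norm ((1/2) *\<^sub>R (R h ** a) - (1/2) *\<^sub>R a) = norm (R (0 + h) - R 0 - h *\<^sub>R (1/2) *\<^sub>R a) / norm h"
        using h by simp
    qed simp
    ultimately show "(\<lambda>h. norm (R (0 + h) - R 0 - h *\<^sub>R (1/2) *\<^sub>R a) / norm h) \<midarrow>0\<rightarrow> 0"
      by (rule Lim_transform_eventually)
  qed
  then have "(u has_vector_derivative 2 *\<^sub>R (1/2) *\<^sub>R a - 0) (at 0)"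
    unfolding u_def by (intro derivative_intros bounded_linear.has_vector_derivative[OF bounded_linear_scaleR_right])
  then have "(u has_vector_derivative a) (at 0)" by simp
  moreover have "u 0 = mat 1" by (simp add: u_def R0 scaleR_2)
  moreover have "continuous_on UNIV u" unfolding u_def by (intro continuous_intros contR)
  ultimately show thesis using that uU by blast
qed

end

section \<open>Infinitesimal motions of an admissible matrix space\<close>

lemma has_vector_derivative_in_subspace:
  fixes f :: "real \<Rightarrow> 'a::euclidean_space"
  assumes S: "subspace S" and f: "(f has_vector_derivative d) (at 0)"
    and ev: "\<forall>\<^sub>F t in nhds 0. f t \<in> S"
  shows "d \<in> S"
proof -
  have f0: "f 0 \<in> S" using eventually_nhds_x_imp_x[OF ev] .
  have "(\<lambda>t. (1 / t) *\<^sub>R (f t - f 0)) \<midarrow>0\<rightarrow> d"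
  proof -
    have "(\<lambda>t. norm (f t - f 0 - t *\<^sub>R d) / norm t) \<midarrow>0\<rightarrow> 0"
      using f unfolding has_vector_derivative_def has_derivative_at by simp
    moreover have "\<forall>\<^sub>F t in at 0. norm (f t - f 0 - t *\<^sub>R d) / norm t = norm ((1 / t) *\<^sub>R (f t - f 0) - d)"
      unfolding eventually_at
    proof (intro exI[of _ 1] conjI ballI impI)
      fix t :: real assume t: "t \<noteq> 0 \<and> dist t 0 < 1"
      then have "f t - f 0 - t *\<^sub>R d = t *\<^sub>R ((1 / t) *\<^sub>R (f t - f 0) - d)" by (simp add: scaleR_diff_right)
      then show "norm (f t - f 0 - t *\<^sub>R d) / norm t = norm ((1 / t) *\<^sub>R (f t - f 0) - d)"
        using t by simp
    qed simp
    ultimately have "(\<lambda>t. norm ((1 / t) *\<^sub>R (f t - f 0) - d)) \<midarrow>0\<rightarrow> 0"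
      by (rule Lim_transform_eventually)
    then show ?thesis using tendsto_norm_zero_cancel[of "\<lambda>t. (1 / t) *\<^sub>R (f t - f 0) - d"]
      by (subst Lim_null)
  qed
  moreover have "\<forall>\<^sub>F t in at 0. (1 / t) *\<^sub>R (f t - f 0) \<in> S"
    using ev
    unfolding eventually_at_filter
    by (auto elim!: eventually_mono intro!: subspace_scale[OF S] subspace_diff[OF S] f0)
  ultimately show ?thesis
    using Lim_in_closed_set[OF closed_subspace[OF S]] by (metis at_neq_bot)
qed

locale matrix_space = matrix_field F for F :: "complex set" +
  fixes X :: "'n::finite cmat set" and N :: "'n cmat \<Rightarrow> real" and o1 :: 'n
  assumes X: "X = matrices F \<or> X = hermitian_matrices F"
    and admissible: "admissible_matrix_space F o1 X N"
begin

lemma X_matrices: "x \<in> X \<Longrightarrow> x \<in> matrices F"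
  using X by (auto simp: hermitian_matrices_def)

lemma uinv: "unitarily_invariant_norm F N"
  using admissible by (simp add: admissible_matrix_space_def)

sublocale normed_subspace X N
proof
  show "subspace X" using admissible by (simp add: admissible_matrix_space_def)
  show "norm_on X N"
    using uinv X_matrices unfolding unitarily_invariant_norm_def norm_on_def by blast
qed

lemma N_unitary: "a \<in> matrices F \<Longrightarrow> u \<in> unitary_matrices F \<Longrightarrow> w \<in> unitary_matrices F \<Longrightarrow> N (u ** a ** w) = N a"
  using uinv unfolding unitarily_invariant_norm_def by metis

lemma one_X: "mat 1 \<in> X"
  using X one_matrices by (auto simp: hermitian_matrices_def)

lemma conjugate_X: "x \<in> X \<Longrightarrow> u \<in> unitary_matrices F \<Longrightarrow> u ** x ** conj_transpose u \<in> X"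
  using X by (auto simp: hermitian_matrices_def ct_mult matrix_mul_assoc
      intro!: mult_matrices ct_matrices dest: unitaryD)

lemma ct_matrix_unit: "conj_transpose (matrix_unit i j :: 'n cmat) = matrix_unit j i"
  by (auto simp: vec_eq_iff ct_nth matrix_unit_def)

lemma matrix_unit_diag_X: "matrix_unit i i \<in> X"
  using X matrix_unit_matrices by (auto simp: hermitian_matrices_def ct_matrix_unit)

lemma matrix_unit_sym_X: "matrix_unit i j + matrix_unit j i \<in> X"
proof -
  have "matrix_unit i j + matrix_unit j i \<in> matrices F"
    by (intro subspace_add subspace_matrices matrix_unit_matrices)
  then show ?thesis
    using X by (elim disjE) (simp_all add: hermitian_matrices_def ct_add ct_matrix_unit add.commute)
qed

text \<open>
Coordinates for the infinitesimal motions. The commutator with \<open>a\<close> depends on \<open>a\<close> only up to scalar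
matrices; the entry at \<open>(o1, o1)\<close> is normalized to \<open>0\<close> to make \<open>a\<close> unique. The third factor is \<open>skew\<close>
if \<open>X\<close> consists of all matrices, and \<open>{0}\<close> if \<open>X\<close> consists of the hermitian ones.
\<close>

definition motion_params :: "('n cmat \<times> 'n cmat \<times> 'n cmat) set" where
  "motion_params = X \<times> {a. a \<in> skew \<and> a $ o1 $ o1 = 0} \<times> {d \<in> X. conj_transpose d = - d}"

text \<open>
The vector field \<open>c + [a, x] + x d\<close>, the velocity at \<open>t = 0\<close> of \<open>t c + u\<^sub>t x u\<^sub>t\<^sup>* v\<^sub>t\<close> for paths of unitary
matrices \<open>u\<close> and \<open>v\<close> that start at the identity with velocities \<open>a\<close> and \<open>d\<close>.
\<close>

definition killing :: "'n cmat \<times> 'n cmat \<times> 'n cmat \<Rightarrow> 'n cmat \<Rightarrow> 'n cmat" where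
  "killing = (\<lambda>(c, a, d) x. c + (a ** x - x ** a) + x ** d)"

lemma killing_linear: "linear (\<lambda>\<pi>. killing \<pi> x)"
  unfolding linear_iff
  by (auto simp: killing_def matmul.add_left matmul.add_right matmul.scaleR_left matmul.scaleR_right
      algebra_simps)

lemma subspace_normalized_skew: "subspace {a :: 'n cmat. a \<in> skew \<and> a $ o1 $ o1 = 0}"
  using subspace_skew[where 'n='n] by (auto simp: subspace_def)

lemma subspace_skew_part: "subspace {d \<in> X. conj_transpose d = - d}"
  by (auto simp: subspace_def ct_add ct_scaleR) (simp add: vec_eq_iff ct_nth)

lemma skew_part_hermitian:
  assumes "X = hermitian_matrices F" shows "{d \<in> X. conj_transpose d = - d} = {0}"
  using assms eq_neg_self_iff by (force simp: hermitian_matrices_def)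

lemma subspace_motion_params: "subspace motion_params"
  unfolding motion_params_def
  by (intro subspace_Times subspace subspace_normalized_skew subspace_skew_part)

text \<open>
The values at \<open>0\<close> and at the identity give \<open>c\<close> and \<open>d\<close>; then \<open>a\<close> commutes with \<open>X\<close>, so by
largeness, applied to the identity in the test set, it is scalar, hence \<open>0\<close> by the normalization.
\<close>

lemma killing_eq_0:
  assumes \<pi>: "\<pi> \<in> motion_params" and z: "\<And>x. x \<in> X \<Longrightarrow> killing \<pi> x = 0"
  shows "\<pi> = 0"
proof -
  obtain c a d where p: "\<pi> = (c, a, d)" by (cases \<pi>)
  have c: "c = 0" using z[of 0] by (simp add: killing_def p)
  have d: "d = 0" using z[OF one_X] by (simp add: killing_def p c)
  have comm: "x ** a = a ** x" if "x \<in> X" for x using z[OF that] by (simp add: killing_def p c d)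
  have a: "a \<in> matrices F" "a $ o1 $ o1 = 0" using \<pi> by (auto simp: p motion_params_def skew_def)
  obtain \<Gamma> where \<Gamma>: "test_set F \<Gamma>" "large_subspace F \<Gamma> X"
    using admissible by (auto simp: admissible_matrix_space_def)
  have "a \<in> twisted_commutant F \<Gamma> X"
    unfolding twisted_commutant_def using \<Gamma>(1) a comm X_matrices
    by (auto simp: test_set_def intro!: bexI[of _ "restrict id (matrices F)"])
  then obtain e where "a = mat e" using \<Gamma>(2) by (auto simp: large_subspace_def)
  then have "a = 0" using a(2) by (auto simp: mat_def vec_eq_iff)
  then show ?thesis using c d p by (simp add: zero_prod_def)
qed

lemma right_unitary_path:
  assumes d: "d \<in> X" "conj_transpose d = - d"
  obtains v where "\<And>t. v t \<in> unitary_matrices F" "v 0 = mat 1" "continuous_on UNIV v"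
    "(v has_vector_derivative d) (at 0)" "\<And>t x. x \<in> X \<Longrightarrow> x ** v t \<in> X"
proof (cases "d = 0")
  case True
  show thesis by (rule that[of "\<lambda>_. mat 1"]) (auto simp: True one_unitary)
next
  case False
  have "X = matrices F" using X skew_part_hermitian d False by blast
  moreover have "d \<in> skew" using d X_matrices by (simp add: skew_def)
  then obtain v where "\<And>t. v t \<in> unitary_matrices F" "v 0 = mat 1" "continuous_on UNIV v"
    "(v has_vector_derivative d) (at 0)" using unitary_path by blast
  ultimately show thesis by (intro that[of v]) (auto intro!: mult_matrices dest: unitaryD)
qed

lemma killing_is_motion:
  assumes \<pi>: "\<pi> \<in> motion_params"
  shows "restrict (killing \<pi>) X \<in> infinitesimal_motions X N"
proof -
  obtain c a d where p: "\<pi> = (c, a, d)" by (cases \<pi>)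
  have P: "c \<in> X" "a \<in> skew" "d \<in> X" "conj_transpose d = - d"
    using \<pi> by (auto simp: p motion_params_def)
  obtain u where u: "\<And>t. u t \<in> unitary_matrices F" "u 0 = mat 1" "continuous_on UNIV u"
    "(u has_vector_derivative a) (at 0)" using unitary_path[OF P(2)] by blast
  obtain v where v: "\<And>t. v t \<in> unitary_matrices F" "v 0 = mat 1" "continuous_on UNIV v"
    "(v has_vector_derivative d) (at 0)" "\<And>t x. x \<in> X \<Longrightarrow> x ** v t \<in> X"
    using right_unitary_path[OF P(3,4)] by blast
  define \<alpha> where "\<alpha> x t = t *\<^sub>R c + u t ** x ** conj_transpose (u t) ** v t" for x t
  have \<alpha>X: "\<alpha> x t \<in> X" if "x \<in> X" for x t
    unfolding \<alpha>_def using that by (intro subspace_mem v(5) conjugate_X u(1) P(1))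
  have \<alpha>': "(\<alpha> x has_vector_derivative killing \<pi> x) (at 0)" for x
  proof -
    have "(\<alpha> x has_vector_derivative 1 *\<^sub>R c + ((u 0 ** x ** conj_transpose (u 0)) ** d +
       ((u 0 ** x) ** conj_transpose a + (u 0 ** 0 + a ** x) ** conj_transpose (u 0)) ** v 0)) (at 0)"
      unfolding \<alpha>_def
      by (intro has_vector_derivative_add matmul.has_vector_derivative has_vector_derivative_const
          bounded_linear.has_vector_derivative[OF conj_transpose_linear] u v
          bounded_linear.has_vector_derivative[OF bounded_linear_scaleR_left] has_vector_derivative_id)
    moreover have "conj_transpose a = - a" using P(2) by (simp add: skew_def)
    ultimately show ?thesis
      by (simp add: u v killing_def p matmul.minus_right algebra_simps)
  qed
  have cont: "continuous_on {-1..1} (\<alpha> x)" for x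
    unfolding \<alpha>_def
    by (intro continuous_intros matmul.continuous_on bounded_linear.continuous_on[OF conj_transpose_linear]
       continuous_on_subset[OF u(3)] continuous_on_subset[OF v(3)]) auto
  have iso: "N (\<alpha> x t - \<alpha> y t) = N (x - y)" if "x \<in> X" "y \<in> X" for x y t
  proof -
    have "\<alpha> x t - \<alpha> y t = u t ** (x - y) ** (conj_transpose (u t) ** v t)"
      by (simp add: \<alpha>_def matmul.diff_left matmul.diff_right matrix_mul_assoc)
    then show ?thesis
      using that by (simp add: N_unitary X_matrices u v mult_unitary ct_unitary)
  qed
  have "rigid_motion X N \<alpha>"
    unfolding rigid_motion_def
  proof (intro conjI ballI)
    fix x assume "x \<in> X"
    then show "\<alpha> x ` {-1..1} \<subseteq> X" using \<alpha>X by auto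
    show "\<alpha> x differentiable at 0" using \<alpha>'[of x] by (rule differentiableI_vector)
    show "\<alpha> x 0 = x" by (simp add: \<alpha>_def u v)
  qed (use cont iso in auto)
  moreover have "killing \<pi> x \<in> X" if "x \<in> X" for x
    using \<alpha>X[OF that] by (intro has_vector_derivative_in_subspace[OF subspace \<alpha>']) auto
  ultimately show ?thesis
    unfolding infinitesimal_motions_def
    using vector_derivative_at[OF \<alpha>'] by (auto intro!: exI[of _ \<alpha>])
qed

text \<open>
A linear isometry has the form \<open>u \<gamma>(x) w\<close> with \<open>\<gamma>\<close> in a finite test set. If the identity of \<open>X\<close> itself
has this form, then \<open>w\<close> is the inverse of \<open>u\<close>, so \<open>u\<close> is in the twisted commutant, hence scalar, and \<open>\<gamma>\<close> is
trivial on \<open>X\<close>. For every other \<open>\<gamma>\<close> the isometries of this form stay away from the identity, because the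
pairs \<open>(u, w)\<close> range over a compact set. A path through the identity therefore uses only
\<open>u x w\<close> at small times.
\<close>

lemma isometry_near_identity:
  assumes lin: "\<And>t. t \<in> {-1..1} \<Longrightarrow> real_linear_on X X (f t)"
    and iso: "\<And>t x. t \<in> {-1..1} \<Longrightarrow> x \<in> X \<Longrightarrow> N (f t x) = N x"
    and lim: "\<And>x. x \<in> X \<Longrightarrow> ((\<lambda>t. f t x) \<longlongrightarrow> x) (nhds (0::real))"
  shows "\<forall>\<^sub>F t in nhds 0. \<exists>u\<in>unitary_matrices F. \<exists>w\<in>unitary_matrices F. \<forall>x\<in>X. f t x = u ** x ** w"
proof -
  let ?U = "unitary_matrices F :: 'n cmat set"
  obtain \<Gamma> where \<Gamma>: "test_set F \<Gamma>" "large_subspace F \<Gamma> X" "isometry_property F \<Gamma> X N"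
    using admissible by (auto simp: admissible_matrix_space_def)
  obtain B where B: "B \<subseteq> X" "independent B" "X \<subseteq> span B" using basis_exists[of X] by metis
  have finB: "finite B" using B(2) by (rule independent_imp_finite)
  have ev: "\<forall>\<^sub>F t in nhds 0. \<not> (\<exists>u\<in>?U. \<exists>w\<in>?U. \<forall>x\<in>X. f t x = u ** \<gamma> x ** w)"
    if \<gamma>: "\<gamma> \<in> \<Gamma>" "\<not> (\<forall>x\<in>X. \<gamma> x = x)" for \<gamma>
  proof -
    have \<gamma>lin: "real_linear_on (matrices F) (matrices F) \<gamma>" "\<gamma> (mat 1) = mat 1"
      using \<Gamma>(1) \<gamma>(1) by (auto simp: test_set_def)
    \<comment> \<open>The distance from the identity, measured on a basis of \<open>X\<close>.\<close>
    define h where "h = (\<lambda>(u, w). \<Sum>b\<in>B. norm (u ** \<gamma> b ** w - b))"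
    have hpos: "h (u, w) > 0" if u: "u \<in> ?U" and w: "w \<in> ?U" for u w
    proof (rule ccontr)
      assume "\<not> h (u, w) > 0"
      moreover have "h (u, w) \<ge> 0" by (simp add: h_def sum_nonneg)
      ultimately have "(\<Sum>b\<in>B. norm (u ** \<gamma> b ** w - b)) = 0" by (simp add: h_def)
      then have b: "\<And>b. b \<in> B \<Longrightarrow> u ** \<gamma> b ** w = b"
        using finB by (subst (asm) sum_nonneg_eq_0_iff) auto
      let ?Y = "{x \<in> X. u ** \<gamma> x ** w = x}"
      have "subspace ?Y"
      proof (intro subspaceI)
        have "\<gamma> 0 = 0"
          using \<gamma>lin(1) subspace_0[OF subspace_matrices] unfolding real_linear_on_def
          by (metis scaleR_zero_left)
        then show "0 \<in> ?Y" by simp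
      next
        fix x y assume "x \<in> ?Y" "y \<in> ?Y"
        then show "x + y \<in> ?Y"
          using \<gamma>lin(1) X_matrices unfolding real_linear_on_def
          by (auto simp: matmul.add_left matmul.add_right)
      next
        fix r x assume "x \<in> ?Y"
        then show "r *\<^sub>R x \<in> ?Y"
          using \<gamma>lin(1) X_matrices unfolding real_linear_on_def
          by (auto simp: matmul.scaleR_left matmul.scaleR_right)
      qed
      then have "span B \<subseteq> ?Y" using b B(1) by (intro span_minimal) auto
      then have fx: "u ** \<gamma> x ** w = x" if "x \<in> X" for x using that B(3) by blast
      have uw: "u ** w = mat 1" using fx[OF one_X] \<gamma>lin(2) by simp
      then have wu: "w ** u = mat 1" using matrix_left_right_inverse by blast
      have "x ** u = u ** \<gamma> x" if "x \<in> X" for x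
      proof -
        have "x ** u = u ** \<gamma> x ** (w ** u)" using fx[OF that] by (metis matrix_mul_assoc)
        then show ?thesis by (simp add: wu)
      qed
      then have "u \<in> twisted_commutant F \<Gamma> X"
        unfolding twisted_commutant_def using \<gamma>(1) unitaryD(1)[OF u] by blast
      then obtain e where e: "u = mat e" using \<Gamma>(2) by (auto simp: large_subspace_def)
      have "\<gamma> x = x" if "x \<in> X" for x
      proof -
        have "\<gamma> x = \<gamma> x ** (u ** w)" by (simp add: uw)
        also have "\<dots> = u ** \<gamma> x ** w" by (simp add: e mat_commute matrix_mul_assoc)
        finally show ?thesis using fx[OF that] by simp
      qed
      then show False using \<gamma>(2) by blast
    qed
    have "compact (?U \<times> ?U)" by (intro compact_Times compact_unitary)
    moreover have "?U \<times> ?U \<noteq> {}" using one_unitary by auto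
    moreover have "continuous_on (?U \<times> ?U) h"
      unfolding h_def case_prod_beta by (intro continuous_intros matmul.continuous_on)
    ultimately obtain m where m: "m \<in> ?U \<times> ?U" "\<And>y. y \<in> ?U \<times> ?U \<Longrightarrow> h m \<le> h y"
      using continuous_attains_inf by metis
    have "h m > 0" using hpos m(1) by (cases m) auto
    moreover have "((\<lambda>t. \<Sum>b\<in>B. norm (f t b - b)) \<longlongrightarrow> (\<Sum>b\<in>B. norm (b - b))) (nhds 0)"
      using B(1) by (intro tendsto_intros lim) auto
    ultimately have "\<forall>\<^sub>F t in nhds 0. (\<Sum>b\<in>B. norm (f t b - b)) < h m"
      using order_tendstoD(2)[of _ "0::real" "nhds 0" "h m"] by simp
    then show ?thesis
    proof (eventually_elim)
      case (elim t)
      show ?case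
      proof safe
        fix u w assume uw: "u \<in> ?U" "w \<in> ?U" "\<forall>x\<in>X. f t x = u ** \<gamma> x ** w"
        then have "h (u, w) = (\<Sum>b\<in>B. norm (f t b - b))"
          unfolding h_def using B(1) by (auto intro!: sum.cong)
        then show False using m(2)[of "(u, w)"] uw elim by auto
      qed
    qed
  qed
  have fin: "finite {\<gamma> \<in> \<Gamma>. \<not> (\<forall>x\<in>X. \<gamma> x = x)}" using \<Gamma>(1) by (simp add: test_set_def)
  have "\<forall>\<^sub>F t in nhds 0. \<forall>\<gamma>\<in>{\<gamma> \<in> \<Gamma>. \<not> (\<forall>x\<in>X. \<gamma> x = x)}.
      \<not> (\<exists>u\<in>?U. \<exists>w\<in>?U. \<forall>x\<in>X. f t x = u ** \<gamma> x ** w)"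
    by (rule eventually_ball_finite[OF fin]) (use ev in blast)
  moreover have "\<forall>\<^sub>F t in nhds 0. t \<in> {-1<..<1::real}" by (intro eventually_nhds_in_open) auto
  ultimately show ?thesis
  proof eventually_elim
    case (elim t)
    then have t: "t \<in> {-1..1}" by auto
    obtain u w \<gamma> where uw: "u \<in> ?U" "w \<in> ?U" "\<gamma> \<in> \<Gamma>" "\<forall>x\<in>X. f t x = u ** \<gamma> x ** w"
      using \<Gamma>(3) lin[OF t] iso[OF t] unfolding isometry_property_def by metis
    then have "\<forall>x\<in>X. \<gamma> x = x" using elim(1) by blast
    then show ?case using uw by auto
  qed
qed

end

lemma matrix_unit_sum: "(\<Sum>k\<in>UNIV. matrix_unit k k) = (mat 1 :: 'n::finite cmat)"
  by (simp add: vec_eq_iff matrix_unit_def mat_def if_distrib cong: if_cong)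
     (auto simp: sum.delta' intro!: sum.neutral)

context matrix_space begin

text \<open>
Subtracting the motion of \<open>0\<close> leaves linear isometries, of the form \<open>u x w\<close> for small \<open>t\<close>, with
\<open>v = u w\<close> the image of the identity and \<open>B x = u x u\<^sup>*\<close>. The motion does not provide differentiable
\<open>u\<close> and \<open>w\<close>, since these are determined only up to a scalar that may depend wildly on \<open>t\<close>. The
matrices \<open>v\<close> and \<open>B x\<close> are differentiable, and so is \<open>q = z\<^sup>* u\<close>, where \<open>z\<close> is the entry of \<open>u\<close> at
\<open>(o1, o1)\<close>, because \<open>q\<close> is a polynomial in values of \<open>B\<close>. The relation \<open>q x = B x q\<close> is linear in
\<open>q\<close>, so its derivative expresses the velocity of \<open>B\<close> as the commutator with \<open>q'\<close>. As \<open>q q\<^sup>*\<close> is a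
real scalar matrix, \<open>q'\<close> is skew-hermitian up to a real scalar, and since its entry at \<open>(o1, o1)\<close> is
real, removing that scalar also yields the normalization.
\<close>

lemma motion_is_killing:
  assumes \<eta>: "\<eta> \<in> infinitesimal_motions X N"
  obtains \<pi> where "\<pi> \<in> motion_params" "\<eta> = restrict (killing \<pi>) X"
proof -
  let ?U = "unitary_matrices F :: 'n cmat set"
  obtain \<alpha> where \<eta>X: "\<eta> \<in> X \<rightarrow>\<^sub>E X" and \<alpha>: "rigid_motion X N \<alpha>"
    and \<eta>\<alpha>: "\<And>x. x \<in> X \<Longrightarrow> \<eta> x = vector_derivative (\<alpha> x) (at 0)"
    using \<eta> by (auto simp: infinitesimal_motions_def)
  have \<alpha>X: "\<alpha> x t \<in> X" if "x \<in> X" "t \<in> {-1..1}" for x t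
    using \<alpha> that unfolding rigid_motion_def by blast
  have \<alpha>0: "\<alpha> x 0 = x" and \<alpha>': "(\<alpha> x has_vector_derivative \<eta> x) (at 0)" if "x \<in> X" for x
    using \<alpha> that \<eta>\<alpha>[OF that] vector_derivative_works unfolding rigid_motion_def by auto
  have \<alpha>iso: "N (\<alpha> x t - \<alpha> y t) = N (x - y)" if "x \<in> X" "y \<in> X" "t \<in> {-1..1}" for x y t
    using \<alpha> that unfolding rigid_motion_def by blast
  define f where "f t x = \<alpha> x t - \<alpha> 0 t" for t x
  define e where "e x = \<eta> x - \<eta> 0" for x
  have f': "((\<lambda>t. f t x) has_vector_derivative e x) (at 0)" if "x \<in> X" for x
    unfolding f_def e_def using that by (intro has_vector_derivative_diff \<alpha>') auto
  have f0: "f 0 x = x" if "x \<in> X" for x using that by (simp add: f_def \<alpha>0)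
  have near: "\<forall>\<^sub>F t in nhds 0. \<exists>u\<in>?U. \<exists>w\<in>?U. \<forall>x\<in>X. f t x = u ** x ** w"
  proof -
    have fX: "f t ` X \<subseteq> X" if "t \<in> {-1..1}" for t
      using \<alpha>X that by (auto simp: f_def)
    have fiso: "N (f t x - f t y) = N (x - y)" if "t \<in> {-1..1}" "x \<in> X" "y \<in> X" for t x y
      using \<alpha>iso[of x y t] that by (simp add: f_def)
    have ft0: "f t 0 = 0" for t by (simp add: f_def)
    have "\<forall>\<^sub>F t in nhds 0. \<exists>u\<in>?U. \<exists>w\<in>?U. \<forall>x\<in>X. restrict (f t) X x = u ** x ** w"
    proof (rule isometry_near_identity)
      fix t :: real assume t: "t \<in> {-1..1}"
      show "real_linear_on X X (restrict (f t) X)"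
        unfolding real_linear_on_def
        using isometry_linear[OF fX[OF t] fiso[OF t] ft0] fX[OF t] by auto
      show "N (restrict (f t) X x) = N x" if "x \<in> X" for x
        using fiso[OF t that, of 0] that by (simp add: ft0)
    next
      fix x assume x: "x \<in> X"
      have "isCont (\<lambda>t. f t x) 0" by (rule has_vector_derivative_continuous[OF f'[OF x]])
      then have "((\<lambda>t. f t x) \<longlongrightarrow> x) (nhds 0)"
        unfolding isCont_def using f0[OF x] tendsto_at_iff_tendsto_nhds[of "\<lambda>t. f t x" 0] by simp
      then show "((\<lambda>t. restrict (f t) X x) \<longlongrightarrow> x) (nhds 0)" using x by simp
    qed
    then show ?thesis by eventually_elim auto
  qed
  define v where "v t = f t (mat 1)" for t
  define d where "d = e (mat 1)"
  have v': "(v has_vector_derivative d) (at 0)" unfolding v_def d_def by (rule f'[OF one_X])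
  have v0: "v 0 = mat 1" by (simp add: v_def f0 one_X)
  have "\<forall>\<^sub>F t in nhds 0. v t \<in> X"
  proof -
    have "\<forall>\<^sub>F t in nhds 0. t \<in> {-1<..<1::real}" by (intro eventually_nhds_in_open) auto
    then show ?thesis
      by eventually_elim (auto simp: v_def f_def intro!: subspace_mem(3) \<alpha>X one_X)
  qed
  then have dX: "d \<in> X" by (rule has_vector_derivative_in_subspace[OF subspace v'])
  define B where "B x t = f t x ** conj_transpose (v t)" for x t
  have B': "(B x has_vector_derivative x ** conj_transpose d + e x) (at 0)" if "x \<in> X" for x
  proof -
    have "(B x has_vector_derivative f 0 x ** conj_transpose d + e x ** conj_transpose (v 0)) (at 0)"
      unfolding B_def
      by (intro matmul.has_vector_derivative f' that
          bounded_linear.has_vector_derivative[OF conj_transpose_linear] v')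
    then show ?thesis by (simp add: f0 that v0)
  qed
  have B0: "B x 0 = x" if "x \<in> X" for x by (simp add: B_def f0 v0 that)
  have nearB: "\<forall>\<^sub>F t in nhds 0. \<exists>u\<in>?U. v t ** conj_transpose (v t) = mat 1 \<and>
      (\<forall>x\<in>X. B x t = u ** x ** conj_transpose u)"
    using near
  proof eventually_elim
    case (elim t)
    then obtain u w where uw: "u \<in> ?U" "w \<in> ?U" "\<And>x. x \<in> X \<Longrightarrow> f t x = u ** x ** w" by blast
    have v: "v t = u ** w" using uw(3)[OF one_X] by (simp add: v_def)
    have "B x t = u ** x ** conj_transpose u" if "x \<in> X" for x
    proof -
      have "B x t = u ** x ** (w ** conj_transpose w) ** conj_transpose u"
        by (simp add: B_def uw(3)[OF that] v ct_mult matrix_mul_assoc)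
      then show ?thesis using unitaryD[OF uw(2)] by simp
    qed
    moreover have "v t \<in> ?U" unfolding v by (intro mult_unitary uw)
    ultimately show ?case using uw(1) unitaryD by blast
  qed
  have d: "conj_transpose d = - d"
  proof -
    have "((\<lambda>t. v t ** conj_transpose (v t)) has_vector_derivative
       v 0 ** conj_transpose d + d ** conj_transpose (v 0)) (at 0)"
      by (intro matmul.has_vector_derivative v'
          bounded_linear.has_vector_derivative[OF conj_transpose_linear])
    then have "((\<lambda>t. v t ** conj_transpose (v t) - mat 1) has_vector_derivative
       (conj_transpose d + d) - 0) (at 0)"
      by (intro has_vector_derivative_diff has_vector_derivative_const) (simp add: v0)
    then have "(conj_transpose d + d) - 0 \<in> {0}"
    proof (rule has_vector_derivative_in_subspace[OF subspace_single_0])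
      show "\<forall>\<^sub>F t in nhds 0. v t ** conj_transpose (v t) - mat 1 \<in> {0}"
        using nearB by eventually_elim auto
    qed
    then show ?thesis by (simp add: eq_neg_iff_add_eq_0)
  qed
  \<comment> \<open>Symmetric elements of \<open>X\<close> from which the matrix units of the column \<open>o1\<close> arise as products.\<close>
  define S where "S k = (if k = o1 then matrix_unit k k else matrix_unit k o1 + matrix_unit o1 k)" for k
  have SX: "S k \<in> X" for k by (auto simp: S_def matrix_unit_diag_X matrix_unit_sym_X)
  have ES: "matrix_unit k k ** S k = matrix_unit k o1" for k
    by (simp add: S_def vec_eq_iff matrix_unit_mult_nth) (auto simp: matrix_unit_def)
  define q where "q t = (\<Sum>k\<in>UNIV. B (matrix_unit k k) t ** B (S k) t ** matrix_unit o1 k)" for t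
  have "\<exists>D. ((\<lambda>t. B (matrix_unit k k) t ** B (S k) t ** matrix_unit o1 k) has_vector_derivative D) (at 0)" for k
    using matmul.has_vector_derivative[OF matmul.has_vector_derivative[OF B'[OF matrix_unit_diag_X]
        B'[OF SX]] has_vector_derivative_const] by (rule exI)
  then obtain D where "\<And>k. ((\<lambda>t. B (matrix_unit k k) t ** B (S k) t ** matrix_unit o1 k)
    has_vector_derivative D k) (at 0)" by metis
  then have "(q has_vector_derivative (\<Sum>k\<in>UNIV. D k)) (at 0)"
    unfolding q_def by (intro has_vector_derivative_sum)
  then obtain q' where q': "(q has_vector_derivative q') (at 0)" by blast
  have EE: "matrix_unit k o1 ** M ** matrix_unit o1 k = mat (M $ o1 $ o1) ** matrix_unit k k"
    for k and M :: "'n cmat"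
    by (auto simp: vec_eq_iff matrix_unit_mult_nth mult_matrix_unit_nth mat_mult_nth)
       (auto simp: matrix_unit_def mat_def)
  have q0: "q 0 = mat 1"
  proof -
    have one: "(mat 1 :: 'n cmat) $ o1 $ o1 = 1" by (simp add: mat_def)
    have "q 0 = (\<Sum>k\<in>UNIV. matrix_unit k o1 ** mat 1 ** matrix_unit o1 k)"
      by (simp add: q_def B0 SX matrix_unit_diag_X ES)
    also have "\<dots> = mat 1" by (simp add: EE one matrix_unit_sum del: matrix_mul_rid)
    finally show ?thesis .
  qed
  have nearq: "\<forall>\<^sub>F t in nhds 0. \<exists>u\<in>?U. q t = mat (cnj (u $ o1 $ o1)) ** u \<and>
     (\<forall>x\<in>X. q t ** x = B x t ** q t)"
    using nearB
  proof eventually_elim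
    case (elim t)
    then obtain u where u: "u \<in> ?U" "\<And>x. x \<in> X \<Longrightarrow> B x t = u ** x ** conj_transpose u" by blast
    define c where "c = cnj (u $ o1 $ o1)"
    have "B (matrix_unit k k) t ** B (S k) t ** matrix_unit o1 k = u ** (mat c ** matrix_unit k k)" for k
    proof -
      have "B (matrix_unit k k) t ** B (S k) t ** matrix_unit o1 k =
        u ** (matrix_unit k k ** (conj_transpose u ** u) ** S k) ** conj_transpose u ** matrix_unit o1 k"
        by (simp add: u(2) SX matrix_unit_diag_X matrix_mul_assoc)
      also have "\<dots> = u ** (matrix_unit k o1 ** conj_transpose u ** matrix_unit o1 k)"
        using unitaryD[OF u(1)] by (simp add: ES matrix_mul_assoc)
      finally show ?thesis by (simp add: EE ct_nth c_def)
    qed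
    then have "q t = u ** (mat c ** (\<Sum>k\<in>UNIV. matrix_unit k k))"
      by (simp add: q_def matmul.sum_right)
    then have "q t = u ** mat c" by (simp add: matrix_unit_sum)
    then have q: "q t = mat c ** u" by (simp add: mat_commute)
    have "q t ** x = B x t ** q t" if "x \<in> X" for x
    proof -
      have "B x t ** q t = mat c ** u ** x ** (conj_transpose u ** u)"
        by (simp add: q u(2)[OF that] mat_commute matrix_mul_assoc)
      then show ?thesis using unitaryD[OF u(1)] by (simp add: q)
    qed
    then show ?case using q u(1) by (auto simp: c_def)
  qed
  have comm: "e x = q' ** x - x ** q' + x ** d" if x: "x \<in> X" for x
  proof -
    have "((\<lambda>t. q t ** x - B x t ** q t) has_vector_derivative
       (q 0 ** 0 + q' ** x) - (B x 0 ** q' + (x ** conj_transpose d + e x) ** q 0)) (at 0)"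
      by (intro has_vector_derivative_diff matmul.has_vector_derivative q' B' x has_vector_derivative_const)
    then have "(q 0 ** 0 + q' ** x) - (B x 0 ** q' + (x ** conj_transpose d + e x) ** q 0) \<in> {0}"
    proof (rule has_vector_derivative_in_subspace[OF subspace_single_0])
      show "\<forall>\<^sub>F t in nhds 0. q t ** x - B x t ** q t \<in> {0}"
        using nearq x by (auto elim!: eventually_mono)
    qed
    then show ?thesis by (simp add: q0 B0 x d matmul.minus_right algebra_simps)
  qed
  have q'F: "q' \<in> matrices F"
  proof (rule has_vector_derivative_in_subspace[OF subspace_matrices q'])
    show "\<forall>\<^sub>F t in nhds 0. q t \<in> matrices F"
      using nearq
    proof eventually_elim
      case (elim t)
      then obtain u where "u \<in> ?U" "q t = mat (cnj (u $ o1 $ o1)) ** u" by blast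
      then show ?case by (auto intro!: mult_matrices mat_matrices F_closed dest!: unitaryD(1))
         (auto simp: matrices_def)
    qed
  qed
  have "q' + conj_transpose q' \<in> span {mat 1}"
  proof -
    have "((\<lambda>t. q t ** conj_transpose (q t)) has_vector_derivative
       q 0 ** conj_transpose q' + q' ** conj_transpose (q 0)) (at 0)"
      by (intro matmul.has_vector_derivative q' bounded_linear.has_vector_derivative[OF conj_transpose_linear])
    then have "q 0 ** conj_transpose q' + q' ** conj_transpose (q 0) \<in> span {mat 1}"
    proof (rule has_vector_derivative_in_subspace[OF subspace_span])
      show "\<forall>\<^sub>F t in nhds 0. q t ** conj_transpose (q t) \<in> span {mat 1}"
        using nearq
      proof eventually_elim
        case (elim t)
        then obtain u where u: "u \<in> ?U" "q t = mat (cnj (u $ o1 $ o1)) ** u" by blast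
        let ?z = "u $ o1 $ o1"
        have "q t ** conj_transpose (q t) = mat (cnj ?z) ** (u ** conj_transpose u) ** mat ?z"
          by (simp add: u(2) ct_mult ct_mat matrix_mul_assoc)
        also have "\<dots> = mat (cnj ?z) ** mat ?z" using unitaryD[OF u(1)] by simp
        also have "\<dots> = (cmod ?z)\<^sup>2 *\<^sub>R mat 1"
          by (simp add: vec_eq_iff mat_mult_nth)
            (auto simp: mat_def scaleR_conv_of_real complex_norm_square mult.commute simp flip: of_real_power)
        finally show ?case by (simp add: span_scale span_base)
      qed
    qed
    then show ?thesis by (simp add: q0 add.commute)
  qed
  then obtain \<rho> where \<rho>: "q' + conj_transpose q' = \<rho> *\<^sub>R mat 1" by (auto simp: span_singleton)
  have q'oo: "q' $ o1 $ o1 \<in> \<real>"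
  proof -
    have "q' \<in> {m :: 'n cmat. m $ o1 $ o1 \<in> \<real>}"
    proof (rule has_vector_derivative_in_subspace[OF _ q'])
      show "subspace {m :: 'n cmat. m $ o1 $ o1 \<in> \<real>}" by (auto simp: subspace_def complex_is_Real_iff)
      show "\<forall>\<^sub>F t in nhds 0. q t \<in> {m. m $ o1 $ o1 \<in> \<real>}"
        using nearq by eventually_elim (auto simp: mat_mult_nth Reals_cnj_iff mult.commute)
    qed
    then show ?thesis by simp
  qed
  define a where "a = q' - (\<rho> / 2) *\<^sub>R mat 1"
  have ca: "conj_transpose a = - a"
  proof -
    have "conj_transpose q' = \<rho> *\<^sub>R mat 1 - q'" using \<rho> by (metis add_diff_cancel_left')
    moreover have "\<rho> *\<^sub>R mat 1 = (\<rho> / 2) *\<^sub>R mat 1 + (\<rho> / 2) *\<^sub>R (mat 1 :: 'n cmat)"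
      by (simp flip: scaleR_add_left)
    ultimately show ?thesis by (simp add: a_def ct_diff ct_scaleR)
  qed
  have "a $ o1 $ o1 \<in> \<real>"
    using q'oo by (simp add: a_def mat_def complex_is_Real_iff)
  moreover have "cnj (a $ o1 $ o1) = - a $ o1 $ o1"
    using arg_cong[OF ca, of "\<lambda>m. m $ o1 $ o1"] by (simp add: ct_nth)
  ultimately have aoo: "a $ o1 $ o1 = 0" by (simp add: Reals_cnj_iff)
  have aF: "a \<in> matrices F"
    unfolding a_def by (intro subspace_diff subspace_scale subspace_matrices q'F one_matrices)
  define \<pi> where "\<pi> = (\<eta> 0, a, d)"
  have "\<pi> \<in> motion_params"
    using \<eta>X aF ca aoo dX d by (auto simp: \<pi>_def motion_params_def skew_def)
  moreover have "\<eta> = restrict (killing \<pi>) X"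
  proof
    fix x
    show "\<eta> x = restrict (killing \<pi>) X x"
    proof (cases "x \<in> X")
      case True
      have "a ** x - x ** a = q' ** x - x ** q'"
        by (simp add: a_def matmul.diff_left matmul.diff_right matmul.scaleR_left matmul.scaleR_right)
      moreover have "\<eta> x = \<eta> 0 + (q' ** x - x ** q') + x ** d"
        using comm[OF True] by (simp add: e_def algebra_simps)
      ultimately have "\<eta> x = killing \<pi> x" by (simp add: killing_def \<pi>_def)
      then show ?thesis using True by simp
    qed (use \<eta>X in auto)
  qed
  ultimately show thesis by (rule that)
qed

end

section \<open>Dimensions\<close>

lemma dim_direct_sum:
  fixes S T W :: "'a::euclidean_space set"
  assumes "subspace S" "subspace T" "S \<inter> T \<subseteq> {0}" "W = {x + y | x y. x \<in> S \<and> y \<in> T}"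
  shows "dim W = dim S + dim T"
proof -
  have "S \<inter> T = {0}" using assms subspace_0 by blast
  then show ?thesis using dim_sums_Int[OF assms(1,2)] assms(4) by simp
qed

lemma dim_linear_image:
  fixes f :: "'a::euclidean_space \<Rightarrow> 'b::euclidean_space"
  assumes "linear f" "inj f"
  shows "dim (f ` S) = dim S"
  using assms by (intro dim_image_eq) (auto intro: inj_on_subset)

lemma dim_real_matrices_supported:
  fixes S :: "('n::finite \<times> 'n) set"
  shows "dim {a :: 'n cmat. a \<in> matrices \<real> \<and> (\<forall>i j. (i, j) \<notin> S \<longrightarrow> a $ i $ j = 0)} = card S"
    (is "dim ?V = _")
proof -
  let ?e = "\<lambda>(i, j). matrix_unit i j :: 'n cmat"
  have inner: "?e s \<bullet> ?e t = (if s = t then 1 else 0)" for s t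
  proof (cases s, cases t)
    fix i j k l assume st: "s = (i, j)" "t = (k, l)"
    have "(matrix_unit i j :: 'n cmat) \<bullet> matrix_unit k l
       = (\<Sum>r\<in>UNIV. \<Sum>c\<in>UNIV. if r = i \<and> c = j \<and> r = k \<and> c = l then 1 else 0)"
      by (auto simp: inner_vec_def matrix_unit_def intro!: sum.cong)
    also have "\<dots> = (\<Sum>r\<in>UNIV. if r = i then (\<Sum>c\<in>UNIV. if c = j then (if i = k \<and> j = l then 1 else 0) else 0) else 0)"
      by (intro sum.cong refl) (auto intro!: sum.neutral sum.cong)
    also have "\<dots> = (if i = k \<and> j = l then 1 else 0)" by simp
    finally show ?thesis by (simp add: st)
  qed
  then have inj: "inj ?e" by (intro injI) (metis zero_neq_one)
  have ind: "independent (?e ` S)"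
  proof (rule pairwise_orthogonal_independent)
    show "pairwise orthogonal (?e ` S)"
      using inner by (auto simp: pairwise_def orthogonal_def)
    show "0 \<notin> ?e ` S" using inner by (metis (no_types, lifting) imageE inner_zero_left zero_neq_one)
  qed
  have sub: "?e ` S \<subseteq> ?V" by (auto simp: matrices_def matrix_unit_def)
  have "?V \<subseteq> span (?e ` S)"
  proof
    fix a assume a: "a \<in> ?V"
    have "a = (\<Sum>s\<in>S. Re (a $ fst s $ snd s) *\<^sub>R ?e s)"
    proof (simp only: vec_eq_iff, intro allI)
      fix i j
      have "(\<Sum>s\<in>S. Re (a $ fst s $ snd s) *\<^sub>R ?e s) $ i $ j
         = (\<Sum>s\<in>S. (Re (a $ fst s $ snd s) *\<^sub>R ?e s) $ i $ j)"
        by (simp only: sum_component)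
      also have "\<dots> = (\<Sum>s\<in>S. if s = (i, j) then complex_of_real (Re (a $ i $ j)) else 0)"
        by (intro sum.cong refl) (auto simp: matrix_unit_def case_prod_beta of_real_def)
      also have "\<dots> = (if (i, j) \<in> S then complex_of_real (Re (a $ i $ j)) else 0)"
        by (simp add: sum.delta)
      also have "\<dots> = a $ i $ j" using a by (auto simp: matrices_def complex_is_Real_iff complex_eq_iff)
      finally show "a $ i $ j = (\<Sum>s\<in>S. Re (a $ fst s $ snd s) *\<^sub>R ?e s) $ i $ j" by simp
    qed
    also have "\<dots> \<in> span (?e ` S)" by (intro span_sum span_scale span_base) auto
    finally show "a \<in> span (?e ` S)" .
  qed
  then have "dim ?V = card (?e ` S)" by (rule basis_card_eq_dim[OF sub _ ind, symmetric])
  also have "\<dots> = card S" using inj by (intro card_image) (rule inj_on_subset, auto)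
  finally show ?thesis .
qed

lemma dim_real_matrices: "dim (matrices \<real> :: 'n::finite cmat set) = (CARD('n))\<^sup>2"
  using dim_real_matrices_supported[of "UNIV :: ('n \<times> 'n) set"]
  by (simp add: power2_eq_square card_cartesian_product flip: UNIV_Times_UNIV)

lemma dim_complex_matrices: "dim (matrices UNIV :: 'n::finite cmat set) = 2 * (CARD('n))\<^sup>2"
proof -
  have "(matrices UNIV :: 'n cmat set) = UNIV" by (auto simp: matrices_def)
  then show ?thesis by (simp add: power2_eq_square)
qed

context matrix_field begin

lemma skew_nth:
  fixes a :: "'n::finite cmat"
  assumes "a \<in> skew" shows "cnj (a $ j $ i) = - a $ i $ j"
proof -
  have "conj_transpose a $ i $ j = (- a) $ i $ j" using assms by (simp add: skew_def)
  then show ?thesis by (simp add: ct_nth)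
qed

lemma skew_matrices: "a \<in> skew \<Longrightarrow> a \<in> matrices F"
  by (simp add: skew_def)

lemma hermitian_nth:
  fixes a :: "'n::finite cmat"
  assumes "a \<in> hermitian_matrices F" shows "cnj (a $ j $ i) = a $ i $ j"
proof -
  have "conj_transpose a $ i $ j = a $ i $ j" using assms by (simp add: hermitian_matrices_def)
  then show ?thesis by (simp add: ct_nth)
qed

lemma subspace_hermitian: "subspace (hermitian_matrices F :: 'n::finite cmat set)"
  using subspace_matrices by (auto simp: subspace_def hermitian_matrices_def ct_add ct_scaleR vec_eq_iff)
   (simp add: ct_nth)

lemma dim_hermitian_skew:
  "dim (matrices F :: 'n::finite cmat set) =
    dim (hermitian_matrices F :: 'n cmat set) + dim (skew :: 'n cmat set)"
proof (rule dim_direct_sum[OF subspace_hermitian subspace_skew])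
  show "hermitian_matrices F \<inter> skew \<subseteq> {0 :: 'n cmat}"
  proof
    fix a :: "'n cmat" assume "a \<in> hermitian_matrices F \<inter> skew"
    then have "a = - a" by (auto simp: hermitian_matrices_def skew_def)
    then show "a \<in> {0}" by (simp add: eq_neg_self_iff)
  qed
  show "(matrices F :: 'n cmat set) = {x + y | x y. x \<in> hermitian_matrices F \<and> y \<in> skew}"
  proof
    show "{x + y | x y. x \<in> hermitian_matrices F \<and> y \<in> skew} \<subseteq> (matrices F :: 'n cmat set)"
      using subspace_add[OF subspace_matrices] by (auto simp: hermitian_matrices_def skew_def)
    show "(matrices F :: 'n cmat set) \<subseteq> {x + y | x y. x \<in> hermitian_matrices F \<and> y \<in> skew}"
    proof
      fix a :: "'n cmat" assume a: "a \<in> matrices F"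
      define x where "x = (1/2) *\<^sub>R (a + conj_transpose a)"
      define y where "y = (1/2) *\<^sub>R (a - conj_transpose a)"
      have "x \<in> matrices F" "y \<in> matrices F" unfolding x_def y_def
        by (intro subspace_scale subspace_add subspace_diff subspace_matrices a ct_matrices)+
      then have "x \<in> hermitian_matrices F" "y \<in> skew"
        by (auto simp: hermitian_matrices_def skew_def x_def y_def ct_scaleR ct_add ct_diff algebra_simps)
      moreover have "a = x + y" by (simp add: x_def y_def algebra_simps flip: scaleR_add_left)
      ultimately show "a \<in> {x + y | x y. x \<in> hermitian_matrices F \<and> y \<in> skew}" by blast
    qed
  qed
qed

end

interpretation real_field: matrix_field \<real> by standard simp
interpretation complex_field: matrix_field UNIV by standard simp

lemma real_skew_diag:
  fixes a :: "'n::finite cmat"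
  assumes "a \<in> real_field.skew" shows "a $ i $ i = 0"
proof -
  have "a $ i $ i \<in> \<real>" using assms by (auto simp: real_field.skew_def matrices_def)
  then show ?thesis using real_field.skew_nth[OF assms, of i i] by (simp add: Reals_cnj_iff)
qed

text \<open>
Zero-diagonal real matrices split into symmetric and skew ones. Flipping the signs of the entries
on one side of the diagonal, for an arbitrary enumeration of the indices, exchanges the two
summands, so each has half the dimension.
\<close>

lemma dim_real_skew: "2 * dim (real_field.skew :: 'n::finite cmat set) + CARD('n) = (CARD('n))\<^sup>2"
proof -
  let ?Z = "{a :: 'n cmat. a \<in> matrices \<real> \<and> (\<forall>i j. (i, j) \<notin> - Id \<longrightarrow> a $ i $ j = 0)}"
  let ?S = "{a \<in> hermitian_matrices \<real>. \<forall>i. a $ i $ i = 0} :: 'n cmat set"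
  let ?K = "real_field.skew :: 'n cmat set"
  have sS: "subspace ?S"
    using real_field.subspace_hermitian[where 'n='n] by (auto simp: subspace_def)
  have "dim ?Z = dim ?S + dim ?K"
  proof (rule dim_direct_sum[OF sS real_field.subspace_skew])
    show "?S \<inter> ?K \<subseteq> {0}"
    proof
      fix a :: "'n cmat" assume "a \<in> ?S \<inter> ?K"
      then have "a = - a" by (auto simp: hermitian_matrices_def real_field.skew_def)
      then show "a \<in> {0}" by (simp add: eq_neg_self_iff)
    qed
    show "?Z = {x + y | x y. x \<in> ?S \<and> y \<in> ?K}"
    proof
      show "{x + y | x y. x \<in> ?S \<and> y \<in> ?K} \<subseteq> ?Z"
        using subspace_add[OF real_field.subspace_matrices[where 'n='n]] real_skew_diag
        by (auto simp: hermitian_matrices_def dest: real_field.skew_matrices)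
      show "?Z \<subseteq> {x + y | x y. x \<in> ?S \<and> y \<in> ?K}"
      proof
        fix a assume a: "a \<in> ?Z"
        define x where "x = (1/2) *\<^sub>R (a + conj_transpose a)"
        define y where "y = (1/2) *\<^sub>R (a - conj_transpose a)"
        have "x \<in> matrices \<real>" "y \<in> matrices \<real>" unfolding x_def y_def using a
          by (auto intro!: subspace_scale subspace_add subspace_diff real_field.subspace_matrices
              real_field.ct_matrices)
        then have "x \<in> ?S" "y \<in> ?K" using a
          by (auto simp: hermitian_matrices_def real_field.skew_def x_def y_def ct_scaleR ct_add ct_diff
             ct_nth algebra_simps)
        moreover have "a = x + y" by (simp add: x_def y_def algebra_simps flip: scaleR_add_left)
        ultimately show "a \<in> {x + y | x y. x \<in> ?S \<and> y \<in> ?K}" by blast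
      qed
    qed
  qed
  moreover have "dim ?S = dim ?K"
  proof -
    obtain r :: "'n \<Rightarrow> nat" where r: "inj r"
      using finite_imp_inj_to_nat_seg[of "UNIV :: 'n set"] by auto
    define \<sigma> :: "'n \<Rightarrow> 'n \<Rightarrow> complex" where "\<sigma> i j = (if r i < r j then - 1 else 1)" for i j
    define g :: "'n cmat \<Rightarrow> 'n cmat" where "g a = (\<chi> i j. \<sigma> i j * a $ i $ j)" for a
    have \<sigma>: "\<sigma> i j * (\<sigma> i j * z) = z" "cnj (\<sigma> i j) = \<sigma> i j" "\<sigma> i j \<in> \<real>" for i j z by (auto simp: \<sigma>_def)
    have \<sigma>': "\<sigma> j i = - \<sigma> i j" if "i \<noteq> j" for i j
      using that injD[OF r, of i j] by (auto simp: \<sigma>_def)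
    have gg: "g (g a) = a" for a by (simp add: g_def vec_eq_iff \<sigma>)
    have lin: "linear g" by (simp add: linear_iff g_def vec_eq_iff algebra_simps)
    have inj: "inj g" using gg by (metis injI)
    have gR: "g a \<in> matrices \<real>" if "a \<in> matrices \<real>" for a
      using that \<sigma> by (auto simp: g_def matrices_def)
    have "g a \<in> ?S" if a: "a \<in> ?K" for a
    proof -
      have "conj_transpose (g a) $ i $ j = g a $ i $ j" for i j
        using real_field.skew_nth[OF a, of j i] real_skew_diag[OF a] \<sigma>'[of i j] by (cases "i = j") (auto simp: ct_nth g_def \<sigma>)
      then show ?thesis using gR a real_skew_diag[OF a]
        by (auto simp: hermitian_matrices_def vec_eq_iff real_field.skew_def) (simp add: g_def)
    qed
    moreover have "g a \<in> ?K" if a: "a \<in> ?S" for a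
    proof -
      have "a \<in> hermitian_matrices \<real>" using a by simp
      then have "conj_transpose (g a) $ i $ j = (- g a) $ i $ j" for i j
        using real_field.hermitian_nth[of a j i] a \<sigma>'[of i j] by (cases "i = j") (auto simp: ct_nth g_def \<sigma>)
      then show ?thesis using gR a
        by (auto simp: hermitian_matrices_def vec_eq_iff real_field.skew_def)
    qed
    ultimately have "g ` ?K = ?S" using gg by (metis (no_types, lifting) image_eqI image_subsetI subsetI subset_antisym)
    then show ?thesis using dim_linear_image[OF lin inj, of ?K] by simp
  qed
  moreover have "dim ?Z + CARD('n) = (CARD('n))\<^sup>2"
  proof -
    have "card (- Id :: ('n \<times> 'n) set) = CARD('n \<times> 'n) - card (Id :: ('n \<times> 'n) set)"
      by (subst Compl_eq_Diff_UNIV, subst card_Diff_subset) auto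
    moreover have "card (Id :: ('n \<times> 'n) set) = CARD('n)"
    proof -
      have "(Id :: ('n \<times> 'n) set) = (\<lambda>i. (i, i)) ` UNIV" by auto
      then have "card (Id :: ('n \<times> 'n) set) = card ((\<lambda>i :: 'n. (i, i)) ` UNIV)" by (rule arg_cong)
      also have "\<dots> = CARD('n)" by (rule card_image) (auto simp: inj_on_def)
      finally show ?thesis .
    qed
    moreover have "CARD('n) \<le> CARD('n) * CARD('n)" by simp
    ultimately show ?thesis
      using dim_real_matrices_supported[of "- Id :: ('n \<times> 'n) set"]
      by (simp add: power2_eq_square)
  qed
  ultimately show ?thesis by linarith
qed

lemma dim_real_hermitian:
  "2 * dim (hermitian_matrices \<real> :: 'n::finite cmat set) = CARD('n) * (CARD('n) + 1)"
  using real_field.dim_hermitian_skew[where 'n='n] dim_real_skew[where 'n='n]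
    dim_real_matrices[where 'n='n] by (simp add: power2_eq_square)

text \<open>
Multiplication by \<open>\<i>\<close> maps the hermitian matrices onto the skew-hermitian ones.
\<close>

lemma dim_complex_hermitian: "dim (hermitian_matrices UNIV :: 'n::finite cmat set) = (CARD('n))\<^sup>2"
  and dim_complex_skew: "dim (complex_field.skew :: 'n::finite cmat set) = (CARD('n))\<^sup>2"
proof -
  define g :: "'n cmat \<Rightarrow> 'n cmat" where "g a = mat \<i> ** a" for a
  have lin: "linear g" by (simp add: linear_iff g_def matmul.add_right matmul.scaleR_right)
  have inj: "inj g" by (rule injI) (auto simp: g_def vec_eq_iff mat_mult_nth)
  have "g ` hermitian_matrices UNIV = complex_field.skew"
  proof
    show "g ` hermitian_matrices UNIV \<subseteq> complex_field.skew"
      by (auto simp: hermitian_matrices_def complex_field.skew_def matrices_def vec_eq_iff g_def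
          mat_mult_nth ct_nth)
    show "complex_field.skew \<subseteq> g ` hermitian_matrices UNIV"
    proof
      fix a :: "'n cmat" assume "a \<in> complex_field.skew"
      then have "cnj (a $ j $ i) = - a $ i $ j" for i j by (rule complex_field.skew_nth)
      then have "mat (- \<i>) ** a \<in> hermitian_matrices UNIV"
        by (simp add: hermitian_matrices_def matrices_def vec_eq_iff mat_mult_nth ct_nth)
      moreover have "a = g (mat (- \<i>) ** a)" by (simp add: g_def vec_eq_iff mat_mult_nth)
      ultimately show "a \<in> g ` hermitian_matrices UNIV" by blast
    qed
  qed
  then have "dim (complex_field.skew :: 'n cmat set) = dim (hermitian_matrices UNIV :: 'n cmat set)"
    using dim_linear_image[OF lin inj, of "hermitian_matrices UNIV"] by simp
  then show "dim (hermitian_matrices UNIV :: 'n cmat set) = (CARD('n))\<^sup>2"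
    "dim (complex_field.skew :: 'n cmat set) = (CARD('n))\<^sup>2"
    using complex_field.dim_hermitian_skew[where 'n='n] dim_complex_matrices[where 'n='n] by simp_all
qed

lemma dim_complex_skew_normalized:
  "dim {a :: 'n::finite cmat. a \<in> complex_field.skew \<and> a $ o1 $ o1 = 0} + 1 = (CARD('n))\<^sup>2"
proof -
  let ?K = "{a :: 'n cmat. a \<in> complex_field.skew \<and> a $ o1 $ o1 = 0}"
  let ?c = "mat \<i> :: 'n cmat"
  have c: "?c $ o1 $ o1 = \<i>" by (simp add: mat_def)
  have cskew: "?c \<in> complex_field.skew"
    by (simp add: complex_field.skew_def matrices_def ct_mat) (simp add: vec_eq_iff mat_def)
  have "dim (complex_field.skew :: 'n cmat set) = dim ?K + dim (span {?c})"
  proof (rule dim_direct_sum)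
    show "subspace ?K" using complex_field.subspace_skew[where 'n='n] by (auto simp: subspace_def)
    show "subspace (span {?c})" by (rule subspace_span)
    show "?K \<inter> span {?c} \<subseteq> {0}" using c by (auto simp: span_singleton)
    show "complex_field.skew = {x + y | x y. x \<in> ?K \<and> y \<in> span {?c}}"
    proof
      show "complex_field.skew \<subseteq> {x + y | x y. x \<in> ?K \<and> y \<in> span {?c}}"
      proof
        fix a :: "'n cmat" assume a: "a \<in> complex_field.skew"
        have "cnj (a $ o1 $ o1) = - a $ o1 $ o1" using a by (rule complex_field.skew_nth)
        then have "Re (a $ o1 $ o1) = 0" by (simp add: complex_eq_iff)
        then have "(a - Im (a $ o1 $ o1) *\<^sub>R ?c) $ o1 $ o1 = 0"
          by (simp add: c complex_eq_iff)
        moreover have "a - Im (a $ o1 $ o1) *\<^sub>R ?c \<in> complex_field.skew"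
          by (intro subspace_diff subspace_scale complex_field.subspace_skew a cskew)
        moreover have "Im (a $ o1 $ o1) *\<^sub>R ?c \<in> span {?c}" by (simp add: span_scale span_base)
        moreover have "a = (a - Im (a $ o1 $ o1) *\<^sub>R ?c) + Im (a $ o1 $ o1) *\<^sub>R ?c" by simp
        ultimately show "a \<in> {x + y | x y. x \<in> ?K \<and> y \<in> span {?c}}" by blast
      qed
      show "{x + y | x y. x \<in> ?K \<and> y \<in> span {?c}} \<subseteq> complex_field.skew"
        using cskew complex_field.subspace_skew[where 'n='n]
        by (auto simp: span_singleton intro!: subspace_add subspace_scale)
    qed
  qed
  moreover have "?c \<noteq> 0" using c by (metis complex_i_not_zero zero_index)
  then have "dim (span {?c}) = 1" by simp
  ultimately show ?thesis by (simp add: dim_complex_skew)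
qed

section \<open>Counting edges with linear algebra\<close>

text \<open>
Velocity assignments live in the space of functions on the vertices, which is infinite-dimensional
when the type of vertices is infinite. The counting is done with finite bases inside it.
\<close>

instantiation "fun" :: (type, real_vector) real_vector
begin

definition scaleR_fun :: "real \<Rightarrow> ('a \<Rightarrow> 'b) \<Rightarrow> 'a \<Rightarrow> 'b" where
  "scaleR_fun r f = (\<lambda>x. r *\<^sub>R f x)"

instance
  by standard (simp_all add: scaleR_fun_def fun_eq_iff scaleR_add_right scaleR_add_left)

end

lemma scaleR_fun_apply [simp]: "(r *\<^sub>R f) x = r *\<^sub>R f x"
  by (simp add: scaleR_fun_def)

text \<open>
The space \<open>X\<^sup>V\<close>; the value \<open>0\<close> outside \<open>V\<close> makes functions with the same values on \<open>V\<close> equal.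
\<close>

definition placements :: "'v set \<Rightarrow> 'a::real_vector set \<Rightarrow> ('v \<Rightarrow> 'a) set" where
  "placements V X = {z. (\<forall>v\<in>V. z v \<in> X) \<and> (\<forall>v. v \<notin> V \<longrightarrow> z v = 0)}"

lemma placements_basis:
  fixes V :: "'v set" and X :: "'a::euclidean_space set"
  assumes V: "finite V" and X: "subspace X"
  obtains B where "B \<subseteq> placements V X" "independent B" "finite B" "card B = card V * dim X"
    "placements V X \<subseteq> span B"
proof -
  have "\<exists>B \<subseteq> placements V X. independent B \<and> finite B \<and> card B = card V * dim X \<and>
      placements V X \<subseteq> span B"
    using V
  proof (induction V rule: finite_induct)
    case empty
    have "placements {} X \<subseteq> {0}" by (auto simp: placements_def fun_eq_iff)
    then show ?case by (intro exI[of _ "{}"]) (auto simp: independent_empty)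
  next
    case (insert w V)
    then obtain B where B: "B \<subseteq> placements V X" "independent B" "finite B" "card B = card V * dim X"
      "placements V X \<subseteq> span B" by blast
    obtain C where C: "C \<subseteq> X" "independent C" "X \<subseteq> span C" "card C = dim X"
      using basis_exists by blast
    have finC: "finite C" using C(2) by (rule independent_imp_finite)
    define single :: "'a \<Rightarrow> 'v \<Rightarrow> 'a" where "single c = (\<lambda>v. if v = w then c else 0)" for c
    have lin: "linear single" by (simp add: linear_iff single_def fun_eq_iff)
    have "single c w = c" for c by (simp add: single_def)
    then have injs: "inj single" by (metis injI)
    have indC: "independent (single ` C)"
      by (rule linear_independent_injective_image[OF lin C(2)]) (use injs inj_on_subset in blast)
    have zero: "z w = 0" if "z \<in> span B" for z
    proof -
      have "subspace {z :: 'v \<Rightarrow> 'a. z w = 0}" by (auto simp: subspace_def)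
      moreover have "B \<subseteq> {z. z w = 0}" using B(1) insert by (auto simp: placements_def)
      ultimately show ?thesis using span_minimal that by blast
    qed
    have single_span: "span (single ` C) = single ` span C"
      by (rule linear_span_image[OF lin])
    have disj: "span B \<inter> span (single ` C) \<subseteq> {0}"
    proof
      fix z assume z: "z \<in> span B \<inter> span (single ` C)"
      then obtain c where c: "z = single c" using single_span by auto
      have "c = 0" using zero[of z] z c by (auto simp: single_def)
      then show "z \<in> {0}" by (simp add: c single_def fun_eq_iff)
    qed
    have ind: "independent (D \<union> B)" if "D \<subseteq> single ` C" for D
    proof -
      have "finite D" using that finC finite_subset by blast
      then show ?thesis using that
      proof (induction D rule: finite_induct)
        case (insert x D)
        have "x \<notin> span (D \<union> B)"
        proof
          assume "x \<in> span (D \<union> B)"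
          then obtain y z where yz: "y \<in> span D" "z \<in> span B" "x = y + z" by (auto simp: span_Un)
          have "x \<in> span (single ` C)" "y \<in> span (single ` C)"
            using insert.prems yz(1) span_mono[of D "single ` C"] by (auto intro: span_base)
          then have "x - y \<in> span (single ` C)" by (rule span_diff)
          then have "z = 0" using yz disj by auto
          then have "x \<in> span D" using yz by simp
          moreover have "independent (insert x D)" using indC insert.prems by (rule independent_mono)
          ultimately show False using insert.hyps by (simp add: independent_insert)
        qed
        then show ?case using insert by (simp add: independent_insert)
      qed (simp add: B(2))
    qed
    have "single ` C \<inter> B = {}"
    proof (rule ccontr)
      assume "single ` C \<inter> B \<noteq> {}"
      then obtain z where z: "z \<in> single ` C" "z \<in> B" by blast
      then have "z = 0" using disj span_base by blast
      then show False using z(2) B(2) dependent_zero by blast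
    qed
    then have "card (single ` C \<union> B) = card (insert w V) * dim X"
      using B finC C(4) insert injs by (subst card_Un_disjoint) (auto simp: card_image inj_on_subset)
    moreover have "single ` C \<union> B \<subseteq> placements (insert w V) X"
    proof -
      have "z w \<in> X" if "z \<in> B" for z
      proof -
        have "z w = 0" using that B(1) insert.hyps by (auto simp: placements_def)
        then show ?thesis using subspace_0[OF X] by simp
      qed
      then show ?thesis
        using B(1) C(1) subspace_0[OF X] by (auto simp: placements_def single_def)
    qed
    moreover have "placements (insert w V) X \<subseteq> span (single ` C \<union> B)"
    proof
      fix z assume z: "z \<in> placements (insert w V) X"
      define y where "y = z - single (z w)"
      have "y \<in> placements V X" using z insert by (auto simp: placements_def y_def single_def)
      moreover have "single (z w) \<in> single ` span C" using z C(3) by (auto simp: placements_def)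
      ultimately have "single (z w) + y \<in> span (single ` C \<union> B)"
        unfolding span_Un single_span using B(5) by blast
      then show "z \<in> span (single ` C \<union> B)" by (simp add: y_def)
    qed
    ultimately show ?case
      using ind[OF order_refl] B(3) finC by (intro exI[of _ "single ` C \<union> B"]) auto
  qed
  then show thesis using that by blast
qed

text \<open>
Vectors \<open>\<zeta> e\<close> dual to the functionals \<open>\<phi> e\<close> are independent modulo the common kernel of the
functionals, which contains the image of \<open>g\<close>.
\<close>

lemma dual_family_basis:
  fixes g :: "'p::euclidean_space \<Rightarrow> 'w::real_vector"
  assumes E: "finite E" and g: "linear g" and P: "subspace P" "inj_on g P"
    and \<phi>: "\<And>e. e \<in> E \<Longrightarrow> linear (\<phi> e :: 'w \<Rightarrow> real)"
    and dual: "\<And>e e'. e \<in> E \<Longrightarrow> e' \<in> E \<Longrightarrow> \<phi> e (\<zeta> e') = (if e = e' then 1 else 0)"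
    and ker: "\<And>e x. e \<in> E \<Longrightarrow> x \<in> P \<Longrightarrow> \<phi> e (g x) = 0"
  shows "\<exists>I. finite I \<and> independent I \<and> card I = dim P + card E \<and> I \<subseteq> g ` P \<union> \<zeta> ` E \<and>
    g ` P \<union> \<zeta> ` E \<subseteq> span I"
proof -
  obtain B where B: "B \<subseteq> P" "independent B" "P \<subseteq> span B" "card B = dim P"
    using basis_exists by blast
  have spanB: "span B = P" using B P(1) by (metis span_subspace)
  have finB: "finite B" using B(2) by (rule independent_imp_finite)
  have gB: "independent (g ` B)"
    using linear_independent_injective_image[OF g B(2)] P(2) spanB by simp
  have cB: "card (g ` B) = dim P" using P(2) B(1,4) by (metis card_image inj_on_subset)
  have "independent (g ` B \<union> \<zeta> ` D) \<and> card (g ` B \<union> \<zeta> ` D) = dim P + card D" if "D \<subseteq> E" for D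
  proof -
    have "finite D" using that E finite_subset by blast
    then show ?thesis using that
    proof (induction D rule: finite_induct)
      case (insert e D)
      have e: "e \<in> E" using insert by auto
      have "subspace {w. \<phi> e w = 0}"
        using \<phi>[OF e] by (auto simp: subspace_def linear_0 linear_add linear_scale)
      moreover have "g ` B \<union> \<zeta> ` D \<subseteq> {w. \<phi> e w = 0}"
        using insert B(1) ker[OF e] dual[OF e] by auto
      ultimately have "span (g ` B \<union> \<zeta> ` D) \<subseteq> {w. \<phi> e w = 0}" by (intro span_minimal)
      then have n: "\<zeta> e \<notin> span (g ` B \<union> \<zeta> ` D)" using dual[OF e e] by auto
      then have n': "\<zeta> e \<notin> g ` B \<union> \<zeta> ` D" by (rule contra_subsetD[OF span_superset])
      then show ?case using insert n n' finB by (simp add: independent_insert)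
    qed (simp add: gB cB)
  qed
  from this[OF order_refl] have "independent (g ` B \<union> \<zeta> ` E)" "card (g ` B \<union> \<zeta> ` E) = dim P + card E"
    by auto
  moreover have "g ` P \<union> \<zeta> ` E \<subseteq> span (g ` B \<union> \<zeta> ` E)"
  proof -
    have "g ` P = span (g ` B)" by (simp add: linear_span_image[OF g] spanB)
    moreover have "span (g ` B) \<subseteq> span (g ` B \<union> \<zeta> ` E)" by (rule span_mono) simp
    moreover have "\<zeta> ` E \<subseteq> span (g ` B \<union> \<zeta> ` E)" by (auto intro: span_base)
    ultimately show ?thesis by simp
  qed
  ultimately show ?thesis using finB E B(1) by (intro exI[of _ "g ` B \<union> \<zeta> ` E"]) auto
qed

text \<open>
The counting principle of the proof: the trivial flexes and a family of velocity assignments dual to the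
edges are independent in \<open>X\<^sup>V\<close>, and they span it as soon as all flexes are trivial.
\<close>

lemma dual_family_card_le:
  fixes g :: "'p::euclidean_space \<Rightarrow> 'v \<Rightarrow> 'a::euclidean_space"
  assumes V: "finite V" and X: "subspace X"
    and E: "finite E" and g: "linear g" and P: "subspace P" "inj_on g P" "g ` P \<subseteq> placements V X"
    and \<phi>: "\<And>e. e \<in> E \<Longrightarrow> linear (\<phi> e :: ('v \<Rightarrow> 'a) \<Rightarrow> real)"
    and dual: "\<And>e e'. e \<in> E \<Longrightarrow> e' \<in> E \<Longrightarrow> \<phi> e (\<zeta> e') = (if e = e' then 1 else 0)"
    and \<zeta>: "\<And>e. e \<in> E \<Longrightarrow> \<zeta> e \<in> placements V X"
    and ker: "\<And>e x. e \<in> E \<Longrightarrow> x \<in> P \<Longrightarrow> \<phi> e (g x) = 0"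
  shows "dim P + card E \<le> card V * dim X"
    and "(\<And>z. z \<in> placements V X \<Longrightarrow> (\<And>e. e \<in> E \<Longrightarrow> \<phi> e z = 0) \<Longrightarrow> z \<in> g ` P) \<Longrightarrow>
      dim P + card E = card V * dim X"
proof -
  obtain B where B: "B \<subseteq> placements V X" "independent B" "finite B" "card B = card V * dim X"
    "placements V X \<subseteq> span B" using placements_basis[OF V X] by blast
  have "\<exists>I. finite I \<and> independent I \<and> card I = dim P + card E \<and> I \<subseteq> g ` P \<union> \<zeta> ` E \<and>
      g ` P \<union> \<zeta> ` E \<subseteq> span I"
    by (rule dual_family_basis[where \<phi> = \<phi>]) (use E g P \<phi> dual ker in auto)
  then obtain I where I: "finite I" "independent I" "card I = dim P + card E"
    "I \<subseteq> g ` P \<union> \<zeta> ` E" "g ` P \<union> \<zeta> ` E \<subseteq> span I" by auto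
  have sub: "I \<subseteq> placements V X" using I(4) P(3) \<zeta> by blast
  show le: "dim P + card E \<le> card V * dim X"
    using independent_span_bound[OF B(3) I(2)] sub B(4,5) I(3) by (metis order_trans)
  assume *: "\<And>z. z \<in> placements V X \<Longrightarrow> (\<And>e. e \<in> E \<Longrightarrow> \<phi> e z = 0) \<Longrightarrow> z \<in> g ` P"
  have subW: "subspace (placements V X)"
    using X by (auto simp: subspace_def placements_def)
  have "placements V X \<subseteq> span I"
  proof
    fix z assume z: "z \<in> placements V X"
    define y where "y = (\<Sum>e\<in>E. \<phi> e z *\<^sub>R \<zeta> e)"
    have "y \<in> placements V X" unfolding y_def
      by (intro subspace_sum[OF subW] subspace_scale[OF subW] \<zeta>)
    then have "z - y \<in> placements V X" using subspace_diff[OF subW z] by blast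
    moreover have "\<phi> e (z - y) = 0" if e: "e \<in> E" for e
    proof -
      have "\<phi> e y = (\<Sum>e'\<in>E. \<phi> e' z * \<phi> e (\<zeta> e'))"
        by (simp add: y_def linear_sum[OF \<phi>[OF e]] linear_scale[OF \<phi>[OF e]])
      also have "\<dots> = (\<Sum>e'\<in>E. if e' = e then \<phi> e z else 0)"
        using dual[OF e] by (intro sum.cong) auto
      also have "\<dots> = \<phi> e z" using E e by simp
      finally show ?thesis by (simp add: linear_diff[OF \<phi>[OF e]])
    qed
    ultimately have "z - y \<in> span I" using * I(5) by blast
    moreover have "y \<in> span I" unfolding y_def using I(5) by (intro span_sum span_scale) auto
    ultimately have "(z - y) + y \<in> span I" by (rule span_add)
    then show "z \<in> span I" by simp
  qed
  then have "card B \<le> card I" using independent_span_bound[OF I(1) B(2)] B(1) by (metis order_trans)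
  then show "dim P + card E = card V * dim X" using le B(4) I(3) by simp
qed

text \<open>
Between two and \<open>2k - 1\<close> vertices the sparsity bound holds for every simple graph: even the complete
graph has few enough edges, as the number of its edges is convex in the number of vertices.
\<close>

lemma card_edges_small:
  fixes k l :: nat
  assumes G: "simple_graph V E" and V: "2 \<le> card V" "card V < 2 * k" and l: "l + 1 \<le> 2 * k"
  shows "int (card E) \<le> int k * int (card V) - int l"
proof -
  define m where "m = int (card V)"
  have "E \<subseteq> {e. e \<subseteq> V \<and> card e = 2}" and fin: "finite V" using G by (auto simp: simple_graph_def)
  then have "card E \<le> card {e. e \<subseteq> V \<and> card e = 2}" by (intro card_mono) auto
  also have "\<dots> = card V choose 2" by (rule n_subsets[OF fin])
  also have "\<dots> = card V * (card V - 1) div 2" by (rule choose_two)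
  finally have "2 * card E \<le> card V * (card V - 1)" by simp
  then have "int (2 * card E) \<le> int (card V * (card V - 1))" by (simp only: of_nat_le_iff)
  also have "\<dots> = m * (m - 1)" using V by (simp add: m_def of_nat_diff)
  finally have e: "2 * int (card E) \<le> m * (m - 1)" by simp
  have m: "2 \<le> m" "m \<le> 2 * int k - 1" using V by (auto simp: m_def)
  \<comment> \<open>For \<open>l = 2k - 1\<close> this product is \<open>2 (k m - l) - m (m - 1)\<close>.\<close>
  have "(m - 2) * (2 * int k - 1 - m) \<ge> 0" using m by simp
  then have "m * (m - 1) \<le> 2 * int k * m - 2 * (2 * int k - 1)" by (simp add: algebra_simps)
  moreover have "int l \<le> 2 * int k - 1" using l by linarith
  ultimately show ?thesis using e by (simp add: m_def)
qed

section \<open>Rigidity\<close>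

context normed_subspace begin

text \<open>
Along the actual motion the distance is constant, and the linear motion with the same velocities
differs from it by \<open>o(t)\<close>. This is why a trivial flex is a flex.
\<close>

lemma motion_preserves_lengths:
  assumes \<eta>: "\<eta> \<in> infinitesimal_motions X N" and x: "x \<in> X" "y \<in> X"
  shows "((\<lambda>t. (1 / t) * (N ((x + t *\<^sub>R \<eta> x) - (y + t *\<^sub>R \<eta> y)) - N (x - y))) \<longlongrightarrow> 0) (at 0)"
proof -
  obtain \<alpha> where \<eta>X: "\<eta> \<in> X \<rightarrow>\<^sub>E X" and \<alpha>: "rigid_motion X N \<alpha>"
    and \<eta>\<alpha>: "\<And>x. x \<in> X \<Longrightarrow> \<eta> x = vector_derivative (\<alpha> x) (at 0)"
    using \<eta> by (auto simp: infinitesimal_motions_def)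
  have \<alpha>X: "\<alpha> x t \<in> X" if "x \<in> X" "t \<in> {-1..1}" for x t
    using \<alpha> that unfolding rigid_motion_def by blast
  have \<alpha>0: "\<alpha> x 0 = x" and \<alpha>': "(\<alpha> x has_vector_derivative \<eta> x) (at 0)" if "x \<in> X" for x
    using \<alpha> that \<eta>\<alpha>[OF that] vector_derivative_works unfolding rigid_motion_def by auto
  have \<alpha>iso: "N (\<alpha> x t - \<alpha> y t) = N (x - y)" if "t \<in> {-1..1}" for t
    using \<alpha> that x unfolding rigid_motion_def by blast
  obtain C where C: "C > 0" "\<And>x. x \<in> X \<Longrightarrow> N x \<le> C * norm x" using N_upper by blast
  define r where "r t = (\<alpha> x t - \<alpha> y t) - (x - y) - t *\<^sub>R (\<eta> x - \<eta> y)" for t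
  have "((\<lambda>t. \<alpha> x t - \<alpha> y t) has_vector_derivative \<eta> x - \<eta> y) (at 0)"
    by (intro has_vector_derivative_diff \<alpha>' x)
  then have "((\<lambda>t. norm (r t) / norm t) \<longlongrightarrow> 0) (at 0)"
    unfolding has_vector_derivative_def has_derivative_at r_def by (simp add: \<alpha>0 x)
  then have "((\<lambda>t. C * (norm (r t) / norm t)) \<longlongrightarrow> C * 0) (at 0)"
    by (intro tendsto_intros)
  then have lim: "((\<lambda>t. C * (norm (r t) / norm t)) \<longlongrightarrow> 0) (at 0)" by simp
  show ?thesis
  proof (rule Lim_null_comparison[OF _ lim])
    have bound: "norm ((1 / t) * (N ((x + t *\<^sub>R \<eta> x) - (y + t *\<^sub>R \<eta> y)) - N (x - y))) \<le> C * (norm (r t) / norm t)"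
      if t: "t \<in> {-1..1}" for t
    proof -
      let ?z = "(x + t *\<^sub>R \<eta> x) - (y + t *\<^sub>R \<eta> y)"
      have mem: "?z \<in> X" "\<alpha> x t - \<alpha> y t \<in> X" using x t \<eta>X \<alpha>X by auto
      have r: "?z - (\<alpha> x t - \<alpha> y t) = - r t" by (simp add: r_def algebra_simps)
      have "\<bar>N ?z - N (x - y)\<bar> = \<bar>N ?z - N (\<alpha> x t - \<alpha> y t)\<bar>" by (simp add: \<alpha>iso[OF t])
      also have "\<dots> \<le> N (?z - (\<alpha> x t - \<alpha> y t))" by (rule N_diff_bound[OF mem])
      also have "\<dots> \<le> C * norm (?z - (\<alpha> x t - \<alpha> y t))" using mem by (intro C(2)) auto
      also have "\<dots> = C * norm (r t)" by (simp only: r norm_minus_cancel)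
      finally have "\<bar>N ?z - N (x - y)\<bar> / \<bar>t\<bar> \<le> C * norm (r t) / \<bar>t\<bar>" by (rule divide_right_mono) simp
      then show ?thesis by (simp add: abs_mult)
    qed
    show "\<forall>\<^sub>F t in at 0. norm ((1 / t) * (N ((x + t *\<^sub>R \<eta> x) - (y + t *\<^sub>R \<eta> y)) - N (x - y)))
        \<le> C * (norm (r t) / norm t)"
      unfolding eventually_at by (intro exI[of _ 1] conjI ballI impI bound) (auto simp: dist_real_def)
  qed
qed

text \<open>
At a well-positioned edge the rate of change of its length is a linear functional of the velocities.
The edge \<open>e\<close> is unordered, but the limit is the same for both orientations.
\<close>

lemma edge_functional:
  assumes G: "framework X V E p" and wp: "well_positioned X N E p" and e: "e \<in> E"
  obtains \<phi> :: "('v \<Rightarrow> 'a) \<Rightarrow> real" where "linear \<phi>"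
    "\<And>z z'. (\<And>v. v \<in> e \<Longrightarrow> z v = z' v) \<Longrightarrow> \<phi> z = \<phi> z'"
    "\<And>v w z. {v, w} = e \<Longrightarrow> z \<in> V \<rightarrow> X \<Longrightarrow>
      ((\<lambda>t. (1 / t) * (N ((p v + t *\<^sub>R z v) - (p w + t *\<^sub>R z w)) - N (p v - p w))) \<longlongrightarrow> \<phi> z) (at 0)"
proof -
  have "e \<subseteq> V" "card e = 2" using G e by (auto simp: framework_def simple_graph_def)
  then obtain s t where st: "e = {s, t}" "s \<in> V" "t \<in> V" by (auto simp: card_2_iff)
  have pX: "p s \<in> X" "p t \<in> X" using G st by (auto simp: framework_def)
  have "smooth_at X N (p s - p t)" using wp e st by (auto simp: well_positioned_def)
  then obtain a where a: "\<And>h. h \<in> X \<Longrightarrow>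
      ((\<lambda>r. (1 / r) * (N ((p s - p t) + r *\<^sub>R h) - N (p s - p t))) \<longlongrightarrow> a \<bullet> h) (at 0)"
    using smooth_imp_Gateaux[of "p s - p t"] pX by blast
  define \<phi> where "\<phi> z = a \<bullet> (z s - z t)" for z :: "'v \<Rightarrow> 'a"
  show thesis
  proof (rule that[of \<phi>])
    show "linear \<phi>" by (simp add: linear_iff \<phi>_def inner_simps algebra_simps)
    show "\<phi> z = \<phi> z'" if "\<And>v. v \<in> e \<Longrightarrow> z v = z' v" for z z' using that st by (simp add: \<phi>_def)
    fix v w :: 'v and z :: "'v \<Rightarrow> 'a" assume vw: "{v, w} = e" and z: "z \<in> V \<rightarrow> X"
    have zX: "z s \<in> X" "z t \<in> X" using z st by auto
    have lim: "((\<lambda>r. (1 / r) * (N ((p s + r *\<^sub>R z s) - (p t + r *\<^sub>R z t)) - N (p s - p t))) \<longlongrightarrow> \<phi> z) (at 0)"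
      using a[of "z s - z t"] zX by (simp add: \<phi>_def algebra_simps)
    from vw st consider "v = s" "w = t" | "v = t" "w = s" by (auto simp: doubleton_eq_iff)
    then show "((\<lambda>r. (1 / r) * (N ((p v + r *\<^sub>R z v) - (p w + r *\<^sub>R z w)) - N (p v - p w))) \<longlongrightarrow> \<phi> z) (at 0)"
    proof cases
      case 2
      have "N ((p t + r *\<^sub>R z t) - (p s + r *\<^sub>R z s)) = N ((p s + r *\<^sub>R z s) - (p t + r *\<^sub>R z t))" for r
        using pX zX by (intro N_diff_commute) auto
      then show ?thesis using lim 2 N_diff_commute[OF pX] by simp
    qed (use lim in simp)
  qed
qed

end

context matrix_space begin

text \<open>
Minimality provides, for every edge \<open>e\<close>, a velocity assignment \<open>\<zeta> e\<close> that changes the length of \<open>e\<close> at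
unit rate and that of no other edge. A functional \<open>\<phi> e\<close> sees only the two ends of \<open>e\<close>, so the
assignments cut down to a vertex set \<open>W\<close> are still dual to the edges inside \<open>W\<close>. By fullness the
infinitesimal motions restrict injectively to \<open>W\<close>. The counting principle then bounds the edges on
\<open>W\<close>, and for \<open>W = V\<close> rigidity turns the bound into an equation.
\<close>

lemma tight_if_minimally_rigid:
  fixes V :: "'v set"
  assumes k: "dim X = k" and l: "dim motion_params = l" "l + 1 \<le> 2 * k"
    and G: "framework X V E p" and full: "completely_full X N V E p"
    and wp: "well_positioned X N E p" and rigid: "minimally_infinitesimally_rigid X N V E p"
  shows "tight_graph k l V E"
proof -
  let ?T = "infinitesimal_motions X N"
  have sg: "simple_graph V E" and finV: "finite V" and pX: "\<And>v. v \<in> V \<Longrightarrow> p v \<in> X"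
    using G by (auto simp: framework_def simple_graph_def)
  have finE: "finite E" using sg finite_subset[of E "Pow V"] by (auto simp: simple_graph_def)
  have edge: "e \<subseteq> V" "\<exists>v w. e = {v, w}" if "e \<in> E" for e
    using sg that by (auto simp: simple_graph_def card_2_iff) blast
  let ?limit = "\<lambda>e \<phi>. \<forall>v w z. {v, w} = e \<longrightarrow> z \<in> V \<rightarrow> X \<longrightarrow>
      ((\<lambda>t. (1 / t) * (N ((p v + t *\<^sub>R z v) - (p w + t *\<^sub>R z w)) - N (p v - p w))) \<longlongrightarrow> \<phi> z) (at 0)"
  let ?local = "\<lambda>e \<phi>. \<forall>z z' :: 'v \<Rightarrow> 'n cmat. (\<forall>v\<in>e. z v = z' v) \<longrightarrow> \<phi> z = (\<phi> z' :: real)"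
  have "\<forall>e\<in>E. \<exists>\<phi>. linear \<phi> \<and> ?local e \<phi> \<and> ?limit e \<phi>"
  proof
    fix e assume e: "e \<in> E"
    show "\<exists>\<phi>. linear \<phi> \<and> ?local e \<phi> \<and> ?limit e \<phi>"
      by (rule edge_functional[OF G wp e]) (intro exI conjI allI impI; blast)
  qed
  from bchoice[OF this] obtain \<phi> where \<phi>: "\<forall>e\<in>E. linear (\<phi> e) \<and> ?local e (\<phi> e) \<and> ?limit e (\<phi> e)" ..
  have lin: "linear (\<phi> e)" if "e \<in> E" for e
    using conjunct1[OF bspec[OF \<phi> that]] .
  have local: "\<phi> e z = \<phi> e z'" if "e \<in> E" "\<And>v. v \<in> e \<Longrightarrow> z v = z' v" for e z z'
    using conjunct1[OF conjunct2[OF bspec[OF \<phi> that(1)]]] that(2) by simp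
  have lim: "((\<lambda>t. (1 / t) * (N ((p v + t *\<^sub>R z v) - (p w + t *\<^sub>R z w)) - N (p v - p w))) \<longlongrightarrow> \<phi> {v, w} z) (at 0)"
    if "{v, w} \<in> E" "z \<in> V \<rightarrow> X" for v w z
    using conjunct2[OF conjunct2[OF bspec[OF \<phi> that(1)]], rule_format, OF refl that(2)] .
  have flex: "infinitesimal_flex X N V D p z \<longleftrightarrow> (\<forall>e\<in>D. \<phi> e z = 0)"
    if D: "D \<subseteq> E" and z: "z \<in> V \<rightarrow> X" for D z
  proof
    assume fl: "infinitesimal_flex X N V D p z"
    show "\<forall>e\<in>D. \<phi> e z = 0"
    proof
      fix e assume e: "e \<in> D"
      then obtain v w where vw: "e = {v, w}" using edge(2)[of e] D by auto
      have "((\<lambda>t. (1 / t) * (N ((p v + t *\<^sub>R z v) - (p w + t *\<^sub>R z w)) - N (p v - p w))) \<longlongrightarrow> 0) (at 0)"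
        using fl e unfolding vw infinitesimal_flex_def by simp
      moreover have "{v, w} \<in> E" using e D vw by auto
      ultimately show "\<phi> e z = 0" unfolding vw using lim z by (intro tendsto_unique[OF at_neq_bot]) simp_all
    qed
  next
    assume z0: "\<forall>e\<in>D. \<phi> e z = 0"
    show "infinitesimal_flex X N V D p z"
      unfolding infinitesimal_flex_def
    proof (intro conjI allI impI z)
      fix v w assume "{v, w} \<in> D"
      then show "((\<lambda>t. (1 / t) * (N ((p v + t *\<^sub>R z v) - (p w + t *\<^sub>R z w)) - N (p v - p w))) \<longlongrightarrow> 0) (at 0)"
        using lim[of v w z] D z z0 by auto
    qed
  qed
  have motion_flex: "\<phi> e (\<lambda>v. \<eta> (p v)) = 0" if "\<eta> \<in> ?T" "e \<in> E" for \<eta> e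
  proof -
    have "\<eta> \<in> X \<rightarrow>\<^sub>E X" using that(1) by (simp add: infinitesimal_motions_def)
    then have z: "(\<lambda>v. \<eta> (p v)) \<in> V \<rightarrow> X" using pX by auto
    have "infinitesimal_flex X N V E p (\<lambda>v. \<eta> (p v))"
      unfolding infinitesimal_flex_def
    proof (intro conjI allI impI z)
      fix v w assume "{v, w} \<in> E"
      then have "v \<in> V" "w \<in> V" using edge(1) by blast+
      then show "((\<lambda>t. (1 / t) * (N ((p v + t *\<^sub>R \<eta> (p v)) - (p w + t *\<^sub>R \<eta> (p w))) - N (p v - p w))) \<longlongrightarrow> 0) (at 0)"
        by (intro motion_preserves_lengths[OF that(1)] pX)
    qed
    then show ?thesis using flex[OF order_refl z] that(2) by blast
  qed
  \<comment> \<open>Deleting an edge \<open>e\<close> creates a flex that changes the length of \<open>e\<close> only.\<close>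
  have "\<exists>z. z \<in> V \<rightarrow> X \<and> (\<forall>e'\<in>E. \<phi> e' z = (if e' = e then 1 else 0))" if e: "e \<in> E" for e
  proof -
    have r: "infinitesimally_rigid X N V E p" "\<not> infinitesimally_rigid X N V (E - {e}) p"
      using rigid e by (auto simp: minimally_infinitesimally_rigid_def)
    then obtain z where z: "infinitesimal_flex X N V (E - {e}) p z" "\<not> trivial_flex X N V p z"
      by (auto simp: infinitesimally_rigid_def)
    have zX: "z \<in> V \<rightarrow> X" using z(1) by (simp add: infinitesimal_flex_def)
    have z0: "\<forall>e'\<in>E - {e}. \<phi> e' z = 0" using flex[of "E - {e}" z] zX z(1) by blast
    have "\<not> infinitesimal_flex X N V E p z" using z(2) r(1) by (auto simp: infinitesimally_rigid_def)
    then have ne: "\<phi> e z \<noteq> 0" using flex[OF order_refl zX] z0 by blast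
    define y where "y = (1 / \<phi> e z) *\<^sub>R z"
    have "y \<in> V \<rightarrow> X" using zX by (auto simp: y_def Pi_iff)
    moreover have "\<phi> e' y = (if e' = e then 1 else 0)" if "e' \<in> E" for e'
      using z0 ne that by (auto simp: y_def linear_scale[OF lin[OF that]])
    ultimately show ?thesis by blast
  qed
  then obtain \<zeta> where \<zeta>: "\<And>e. e \<in> E \<Longrightarrow> \<zeta> e \<in> V \<rightarrow> X"
    "\<And>e e'. e \<in> E \<Longrightarrow> e' \<in> E \<Longrightarrow> \<phi> e (\<zeta> e') = (if e = e' then 1 else 0)"
    by metis
  define cut :: "'v set \<Rightarrow> ('v \<Rightarrow> 'n cmat) \<Rightarrow> 'v \<Rightarrow> 'n cmat"
    where "cut W z = (\<lambda>v. if v \<in> W then z v else 0)" for W z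
  define g where "g W \<pi> = cut W (\<lambda>v. killing \<pi> (p v))" for W \<pi>
  have cut: "cut W z \<in> placements W X" if "W \<subseteq> V" "z \<in> V \<rightarrow> X" for W z
    using that by (auto simp: cut_def placements_def)
  have kill_mem: "restrict (killing \<pi>) X \<in> ?T" "(\<lambda>v. killing \<pi> (p v)) \<in> V \<rightarrow> X"
    if "\<pi> \<in> motion_params" for \<pi>
  proof -
    show T: "restrict (killing \<pi>) X \<in> ?T" by (rule killing_is_motion[OF that])
    then have "restrict (killing \<pi>) X \<in> X \<rightarrow>\<^sub>E X" by (simp add: infinitesimal_motions_def)
    then show "(\<lambda>v. killing \<pi> (p v)) \<in> V \<rightarrow> X" using pX by (auto simp: PiE_iff)
  qed
  have g_lin: "linear (g W)" for W
    using killing_linear by (auto simp: linear_iff g_def cut_def fun_eq_iff)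
  have g_inj: "inj_on (g W) motion_params" if W: "W \<subseteq> V" and fW: "full_framework X N W p" for W
  proof (rule inj_onI)
    fix \<pi> \<pi>' assume \<pi>: "\<pi> \<in> motion_params" "\<pi>' \<in> motion_params" and eq: "g W \<pi> = g W \<pi>'"
    have "killing \<pi> (p v) = killing \<pi>' (p v)" if "v \<in> W" for v
      using fun_cong[OF eq, of v] that by (simp add: g_def cut_def)
    then have "restrict (restrict (killing \<pi>) X) (p ` W) = restrict (restrict (killing \<pi>') X) (p ` W)"
      by (auto simp: fun_eq_iff)
    moreover have "inj_on (\<lambda>\<eta>. restrict \<eta> (p ` W)) ?T"
      using fW by (simp add: full_framework_def full_set_def)
    ultimately have eqX: "restrict (killing \<pi>) X = restrict (killing \<pi>') X"
      using kill_mem(1)[OF \<pi>(1)] kill_mem(1)[OF \<pi>(2)] by (simp add: inj_on_def)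
    have "\<pi> - \<pi>' = 0"
    proof (rule killing_eq_0)
      show "\<pi> - \<pi>' \<in> motion_params" by (rule subspace_diff[OF subspace_motion_params \<pi>])
      fix x assume "x \<in> X"
      then show "killing (\<pi> - \<pi>') x = 0"
        using fun_cong[OF eqX, of x] linear_diff[OF killing_linear[of x], of \<pi> \<pi>'] by simp
    qed
    then show "\<pi> = \<pi>'" by simp
  qed
  have sub_data:
    "g W ` motion_params \<subseteq> placements W X"
    "\<And>e. e \<in> D \<Longrightarrow> linear (\<phi> e)"
    "\<And>e e'. e \<in> D \<Longrightarrow> e' \<in> D \<Longrightarrow> \<phi> e (cut W (\<zeta> e')) = (if e = e' then 1 else 0)"
    "\<And>e. e \<in> D \<Longrightarrow> cut W (\<zeta> e) \<in> placements W X"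
    "\<And>e \<pi>. e \<in> D \<Longrightarrow> \<pi> \<in> motion_params \<Longrightarrow> \<phi> e (g W \<pi>) = 0"
    if sub: "is_subgraph W D V E" for W D
  proof -
    have W: "W \<subseteq> V" "D \<subseteq> E" "\<And>e. e \<in> D \<Longrightarrow> e \<subseteq> W"
      using sub by (auto simp: is_subgraph_def simple_graph_def)
    have cut_\<phi>: "\<phi> e (cut W z) = \<phi> e z" if "e \<in> D" for e z
      using W that by (intro local) (auto simp: cut_def)
    show "g W ` motion_params \<subseteq> placements W X"
      using cut[OF W(1) kill_mem(2)] by (auto simp: g_def)
    show "linear (\<phi> e)" if "e \<in> D" for e using lin that W by blast
    show "\<phi> e (cut W (\<zeta> e')) = (if e = e' then 1 else 0)" if "e \<in> D" "e' \<in> D" for e e'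
      unfolding cut_\<phi>[OF that(1)] using that W(2) by (intro \<zeta>(2)) auto
    show "cut W (\<zeta> e) \<in> placements W X" if "e \<in> D" for e
      using that W by (intro cut \<zeta>(1)) auto
    show "\<phi> e (g W \<pi>) = 0" if "e \<in> D" "\<pi> \<in> motion_params" for e \<pi>
    proof -
      have e: "e \<in> E" "e \<subseteq> V" using that W edge by auto
      have "\<phi> e (g W \<pi>) = \<phi> e (\<lambda>v. restrict (killing \<pi>) X (p v))"
        unfolding g_def cut_\<phi>[OF that(1)] using e pX by (intro local) auto
      then show ?thesis using motion_flex[OF kill_mem(1)[OF that(2)] e(1)] by simp
    qed
  qed
  have "sparse_graph k l V E"
    unfolding sparse_graph_def
  proof (intro allI impI, elim conjE)
    fix W D assume sub: "is_subgraph W D V E" and W2: "2 \<le> card W"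
    have sgW: "simple_graph W D" and W: "W \<subseteq> V" and D: "D \<subseteq> E"
      using sub by (auto simp: is_subgraph_def)
    show "int (card D) \<le> int k * int (card W) - int l"
    proof (cases "card W < 2 * k")
      case True
      then show ?thesis by (rule card_edges_small[OF sgW W2 _ l(2)])
    next
      case False
      then have "full_framework X N W p" using full sub k by (auto simp: completely_full_def)
      then have "dim motion_params + card D \<le> card W * dim X"
        using finite_subset[OF W finV] finite_subset[OF D finE] sub_data[OF sub] g_inj[OF W]
        by (intro dual_family_card_le(1)[where g = "g W" and \<phi> = \<phi> and \<zeta> = "\<lambda>e. cut W (\<zeta> e)"]
            subspace subspace_motion_params g_lin) auto
      then have "int (l + card D) \<le> int (card W * k)" using k l(1) by (simp only: of_nat_le_iff)
      then show ?thesis by (simp add: mult.commute)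
    qed
  qed
  moreover have "int (card E) = int k * int (card V) - int l"
  proof -
    have sub: "is_subgraph V E V E" using sg by (simp add: is_subgraph_def)
    have fullV: "full_framework X N V p" using full by (simp add: completely_full_def)
    have ker: "z \<in> g V ` motion_params"
      if z: "z \<in> placements V X" "\<And>e. e \<in> E \<Longrightarrow> \<phi> e z = 0" for z
    proof -
      have zX: "z \<in> V \<rightarrow> X" using z(1) by (auto simp: placements_def)
      then have "infinitesimal_flex X N V E p z" using flex[OF order_refl zX] z(2) by blast
      then have "trivial_flex X N V p z"
        using rigid by (auto simp: minimally_infinitesimally_rigid_def infinitesimally_rigid_def)
      then obtain \<eta> where \<eta>: "\<eta> \<in> ?T" "\<And>v. v \<in> V \<Longrightarrow> z v = \<eta> (p v)" by (auto simp: trivial_flex_def)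
      obtain \<pi> where \<pi>: "\<pi> \<in> motion_params" "\<eta> = restrict (killing \<pi>) X"
        using motion_is_killing[OF \<eta>(1)] by blast
      have "z = g V \<pi>"
        using \<eta>(2) \<pi>(2) pX z(1) by (auto simp: g_def cut_def placements_def fun_eq_iff)
      then show ?thesis using \<pi>(1) by blast
    qed
    have "dim motion_params + card E = card V * dim X"
      by (rule dual_family_card_le(2)[where g = "g V" and \<phi> = \<phi> and \<zeta> = "\<lambda>e. cut V (\<zeta> e)",
            OF finV subspace finE g_lin subspace_motion_params g_inj[OF order_refl fullV]])
         (use sub_data[OF sub] ker in auto)
    then have "int (l + card E) = int (card V * k)" using k l(1) by simp
    then show ?thesis by (simp add: mult.commute)
  qed
  ultimately show ?thesis by (simp add: tight_graph_def)
qed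

lemma dim_motion_params:
  "dim motion_params = dim X + dim {a :: 'n cmat. a \<in> skew \<and> a $ o1 $ o1 = 0} +
    dim {d \<in> X. conj_transpose d = - d}"
  unfolding motion_params_def
  by (simp add: dim_Times subspace_Times subspace subspace_normalized_skew subspace_skew_part)

end

text \<open>
It remains to compare dimensions: in each of the four cases \<open>k\<close> is the dimension of \<open>X\<close> and \<open>l\<close> the
dimension of the space of infinitesimal motions.
\<close>

theorem theorem3p15:
  fixes F :: "complex set"
    and X :: "(complex^'n^'n) set"
    and N :: "complex^'n^'n \<Rightarrow> real"
    and o1 :: 'n
    and k l :: nat
    and V :: "'v set"
    and E :: "'v set set"
    and p :: "'v \<Rightarrow> complex^'n^'n"
  assumes "CARD('n) \<ge> 2"
    and "(F, X, k, l) \<in>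
      {(\<real>, hermitian_matrices \<real>, CARD('n) * (CARD('n) + 1) div 2, (CARD('n))\<^sup>2),
       (\<real>, matrices \<real>, (CARD('n))\<^sup>2, 2 * (CARD('n))\<^sup>2 - CARD('n)),
       (UNIV, hermitian_matrices UNIV, (CARD('n))\<^sup>2, 2 * (CARD('n))\<^sup>2 - 1),
       (UNIV, matrices UNIV, 2 * (CARD('n))\<^sup>2, 4 * (CARD('n))\<^sup>2 - 1)}"
    and "admissible_matrix_space F o1 X N"
    and "framework X V E p"
    and "completely_full X N V E p"
    and "well_positioned X N E p"
    and "minimally_infinitesimally_rigid X N V E p"
  shows "tight_graph k l V E"
proof -
  interpret matrix_space F X N o1
    by standard (use assms(2,3) in auto)
  have real: "{a :: 'n cmat. a \<in> real_field.skew \<and> a $ o1 $ o1 = 0} = real_field.skew"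
    using real_skew_diag by auto
  have mat_skew: "{d \<in> matrices F. conj_transpose d = - d} = (skew :: 'n cmat set)"
    by (simp add: skew_def)
  have sq: "CARD('n) * (CARD('n) + 1) = (CARD('n))\<^sup>2 + CARD('n)" by (simp add: power2_eq_square)
  from assms(2) consider
      "F = \<real>" "X = hermitian_matrices \<real>" "k = CARD('n) * (CARD('n) + 1) div 2" "l = (CARD('n))\<^sup>2"
    | "F = \<real>" "X = matrices \<real>" "k = (CARD('n))\<^sup>2" "l = 2 * (CARD('n))\<^sup>2 - CARD('n)"
    | "F = UNIV" "X = hermitian_matrices UNIV" "k = (CARD('n))\<^sup>2" "l = 2 * (CARD('n))\<^sup>2 - 1"
    | "F = UNIV" "X = matrices UNIV" "k = 2 * (CARD('n))\<^sup>2" "l = 4 * (CARD('n))\<^sup>2 - 1"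
    by auto
  then have "dim X = k \<and> dim motion_params = l \<and> l + 1 \<le> 2 * k"
  proof cases
    case 1
    have "dim X = k" using dim_real_hermitian[where 'n='n] by (simp only: 1(2,3))
    moreover have "dim motion_params = dim X + dim (real_field.skew :: 'n cmat set)"
      using dim_motion_params skew_part_hermitian 1(1,2) real by simp
    ultimately show ?thesis
      using dim_real_skew[where 'n='n] sq 1(3,4) dim_real_hermitian[where 'n='n] 1(2) assms(1)
      by (simp only:) presburger
  next
    case 2
    have "dim X = k" using dim_real_matrices[where 'n='n] by (simp only: 2(2,3))
    moreover have "dim motion_params = dim X + 2 * dim (real_field.skew :: 'n cmat set)"
      using dim_motion_params mat_skew 2(1,2) real by simp
    ultimately show ?thesis
      using dim_real_skew[where 'n='n] 2(3,4) assms(1) by linarith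
  next
    case 3
    have "dim X = k" using dim_complex_hermitian[where 'n='n] by (simp only: 3(2,3))
    moreover have "dim motion_params = dim X + dim {a :: 'n cmat. a \<in> complex_field.skew \<and> a $ o1 $ o1 = 0}"
      using dim_motion_params skew_part_hermitian 3(1,2) by simp
    ultimately show ?thesis
      using dim_complex_skew_normalized[of o1] 3(3,4) by linarith
  next
    case 4
    have "dim X = k" using dim_complex_matrices[where 'n='n] by (simp only: 4(2,3))
    moreover have "dim motion_params = dim X + dim {a :: 'n cmat. a \<in> complex_field.skew \<and> a $ o1 $ o1 = 0}
        + dim (complex_field.skew :: 'n cmat set)"
      using dim_motion_params mat_skew 4(1,2) by simp
    ultimately show ?thesis
      using dim_complex_skew_normalized[of o1] dim_complex_skew[where 'n='n] 4(3,4) by linarith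
  qed
  then show ?thesis
    using tight_if_minimally_rigid[OF _ _ _ assms(4-7)] by blast
qed

end
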